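(* Let $K$ be a field, let $f(x) \in K[x]$ be a polynomial of degree at least $2$, and let $c, d, m, n$ be integers with $c, m \geq 0$ and $d, n \geq 1$. Suppose that (1) either $m > c$ or $n \nmid d$, (2) the cocore of $d$ is at least $m - \max(c-1, 0)$, and (3) $x^n - 1$ divides the $d$th necklace polynomial $M_d(x)$ in $\mathbb{Q}[x]$. Then $\Phi_{f,m,n}(x)$ divides $\Phi_{f,c,d}(x) - 1$ in $K[x]$. Alternatively, if $d > 1$, $c - 1 \geq m$, and $n = 1$ (with no assumption of (1), (2), (3)), then $\Phi_{f,m,n}(x)$ divides $\Phi_{f,c,d}(x) - 1$ in $K[x]$.
   Context: For $k \ge 0$, $f^k$ denotes the $k$-fold iterated composition of $f$ with itself ($f^0(x) = x$). $\mu$ is the number-theoretic Möbius function. For $d \ge 1$, the $d$th dynatomic polynomial of $f$ is $\Phi_{f,d}(x) := \prod_{e \mid d} (f^{d/e}(x) - x)^{\mu(e)}$. For $m \ge 0$, $n \ge 1$, the $(m,n)$th generalized dynatomic polynomial is defined by $\Phi_{f,0,n}(x) := \Phi_{f,n}(x)$ and, for $m \geq 1$, $\Phi_{f,m,n}(x) := \Phi_{f,n}(f^m(x))/\Phi_{f,n}(f^{m-1}(x))$. It is known that for $f$ of degree at least $2$ these a priori rational functions are polynomials in $K[x]$. The cocore of a positive integer $d$ is $d/d'$, where $d'$ is the largest squarefree factor of $d$. The $d$th necklace polynomial is $M_d(x) := \frac{1}{d}\sum_{e \mid d} \mu(e) x^{d/e} \in \mathbb{Q}[x]$ (always considered over $\mathbb{Q}$,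 regardless of $K$). *)

theory Defs
  imports "HOL-Computational_Algebra.Computational_Algebra"
begin

definition moebius_mu :: "nat \<Rightarrow> int" where
  "moebius_mu d = (if squarefree d then (-1) ^ card (prime_factors d) else 0)"

definition poly_iterate :: "'a::field poly \<Rightarrow> nat \<Rightarrow> 'a poly" where
  "poly_iterate f k = (pcompose f ^^ k) [:0, 1:]"

(* The polynomial in K[x] equal to a given element of K(x). It is meaningful only if that
   rational function is a polynomial; for the dynatomic quotients below this is a known fact
   when f has degree at least 2. *)
definition poly_of_fract :: "'a::field poly fract \<Rightarrow> 'a poly" where
  "poly_of_fract r = (THE p. to_fract p = r)"

definition dynatomic :: "'a::field poly \<Rightarrow> nat \<Rightarrow> 'a poly" where
  "dynatomic f d = poly_of_fract
     (\<Prod>e | e dvd d. to_fract (poly_iterate f (d div e) - [:0, 1:]) powi moebius_mu e)"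

fun gen_dynatomic :: "'a::field poly \<Rightarrow> nat \<Rightarrow> nat \<Rightarrow> 'a poly" where
  "gen_dynatomic f 0 n = dynatomic f n"
| "gen_dynatomic f (Suc m) n = poly_of_fract
     (to_fract (pcompose (dynatomic f n) (poly_iterate f (Suc m)))
      / to_fract (pcompose (dynatomic f n) (poly_iterate f m)))"

definition cocore :: "nat \<Rightarrow> nat" where
  "cocore d = d div Max {e. e dvd d \<and> squarefree e}"

definition necklace_poly :: "nat \<Rightarrow> rat poly" where
  "necklace_poly d =
     smult (1 / of_nat d) (\<Sum>e | e dvd d. monom (of_int (moebius_mu e)) (d div e))"

end

theory Submission
  imports Defs
begin

text \<open>
  Write \<open>F\<^sub>j = f\<^sup>j(x) - x\<close>. By definition the polynomial on the right is, up to the term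
  \<open>-1\<close>, a product over divisors \<open>e\<close> of \<open>d\<close> of factors built from \<open>F\<^sub>d\<^sub>/\<^sub>e\<close>, evaluated at
  \<open>f\<^sup>c(x)\<close> and \<open>f\<^sup>c\<^sup>-\<^sup>1(x)\<close>, with exponents \<open>\<mu>(e)\<close>. The polynomial \<open>\<Phi>\<close> with indices \<open>m, n\<close> divides
  \<open>f\<^sup>m\<^sup>+\<^sup>n(x) - f\<^sup>m(x)\<close>, so modulo \<open>\<Phi>\<close> an iterate \<open>f\<^sup>k(x)\<close> with \<open>k \<ge> m\<close> depends only on \<open>k\<close> modulo
  \<open>n\<close>. By the bound on the cocore all iterates with large index that occur are in this range. The
  divisibility of the necklace polynomial by \<open>x\<^sup>n - 1\<close> says that the exponents \<open>\<mu>(e)\<close> sum to zero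
  over each class of codivisors \<open>d / e\<close> modulo \<open>n\<close> (\<open>necklace_poly_balanced\<close>). If all factors were
  units modulo \<open>\<Phi>\<close>, the product would thus be \<open>1\<close>.

  The factors need not be units, and the work lies in the primes \<open>\<pi>\<close> at which they are not. The
  argument is local: for each prime \<open>\<pi>\<close> of \<open>K[x]\<close> dividing \<open>\<Phi>\<close> to the power \<open>A\<close>, the quotient of two
  factors whose codivisors agree modulo \<open>n\<close> is shown to be \<open>1\<close> modulo \<open>\<pi>\<^sup>A\<close>. Such quotients
  form a group (\<open>principal_units\<close>), and a product with balanced exponents lies in that group
  (\<open>principal_units_balanced_prod\<close>). The local statement is \<open>orbit_diff_cong_mod_gen_dynatomic\<close>. It
  rests on two facts. The valuation of the \<open>n\<close>th dynatomic polynomial is the valuation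
  of \<open>F\<^sub>n\<close> minus the largest valuation of \<open>F\<^sub>h\<close> for proper divisors \<open>h\<close> of \<open>n\<close>; this leaves
  just the required margin when \<open>n\<close> does not divide \<open>d / e\<close>. And a periodic point can be a zero of \<open>\<Phi>\<close>
  with \<open>m > 0\<close> only if its cycle is superattracting (the derivative of \<open>f\<close> vanishes somewhere on it),
  and in that case the valuations along the cycle are rigid.

  The formula for the valuation comes from strong divisibility: \<open>F\<^sub>i\<close> and \<open>F\<^sub>j\<close> have greatest
  common divisor \<open>F\<^sub>g\<close> with \<open>g = gcd i j\<close>, since periods of an orbit are closed under greatest
  common divisors. The Moebius product over such a sequence is \<open>F\<^sub>n\<close> divided by a least common
  multiple (\<open>moebius_sum_strong_divisibility\<close>). This shows in passing that
  the dynatomic quotients are polynomials, which gives the definitions their meaning; a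
  similar local comparison of \<open>x\<close> with \<open>f(x)\<close> handles the generalized ones
  (\<open>dynatomic_dvd_dynatomic_iterate_1\<close>).

  In the alternative with \<open>n = 1\<close> and \<open>c > m\<close> all codivisors are congruent and the exponents sum to
  zero because \<open>d > 1\<close>. Each factor is then a difference quotient of \<open>f\<close> at two points that coincide
  modulo \<open>\<pi>\<^sup>A\<close>, hence congruent to the multiplier of a fixed point. If that is a unit, this
  suffices; otherwise the fixed point is superattracting, and there the
  multiplier vanishes to at least the order of \<open>f(x) - x\<close> (\<open>vord_multiplier_ge\<close>).
\<close>

section \<open>Valuations on polynomials over a field\<close>

text \<open>Greatest common divisors of polynomials enter below through this identity.\<close>
lemma poly_bezout:
  fixes a b :: "'a::field poly"
  shows "\<exists>g u v. g dvd a \<and> g dvd b \<and> g = u * a + v * b"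
proof (induction "euclidean_size b" arbitrary: a b rule: less_induct)
  case less
  show ?case
  proof (cases "b = 0")
    case True
    then show ?thesis by (intro exI[of _ a] exI[of _ 1] exI[of _ 0]) simp
  next
    case False
    then have "euclidean_size (a mod b) < euclidean_size b" by (rule mod_size_less)
    from less[OF this, of b] obtain g u v
      where g: "g dvd b" "g dvd a mod b" "g = u * b + v * (a mod b)" by blast
    have "a mod b = a - a div b * b" by (simp add: minus_div_mult_eq_mod)
    with g(3) have "g = u * b + v * (a - a div b * b)" by simp
    then have "g = v * a + (u - v * (a div b)) * b"
      by (simp add: left_diff_distrib right_diff_distrib mult.assoc)
    moreover have "g dvd a" using g(1,2) by (simp add: dvd_mod_iff)
    ultimately show ?thesis using g(1) by blast
  qed
qed

lemma prime_divisor_poly_exists: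
  fixes x :: "'a::field poly"
  assumes "x \<noteq> 0" "\<not> is_unit x"
  shows "\<exists>\<pi>. prime_elem \<pi> \<and> \<pi> dvd x"
  using assms
proof (induction "degree x" arbitrary: x rule: less_induct)
  case less
  show ?case
  proof (cases "irreducible x")
    case True
    then have "prime_elem x" by (rule field_poly_irreducible_imp_prime)
    then show ?thesis by (intro exI[of _ x] conjI dvd_refl)
  next
    case False
    then obtain a b where ab: "x = a * b" "\<not> is_unit a" "\<not> is_unit b"
      using less.prems unfolding irreducible_def by blast
    have nz: "a \<noteq> 0" "b \<noteq> 0" using less.prems(1) unfolding ab(1) by auto
    have "degree b > 0" using ab(3) nz(2) is_unit_iff_degree by blast
    then have "degree a < degree x" using ab(1) nz by (simp add: degree_mult_eq)
    then obtain \<pi> where "prime_elem \<pi>" "\<pi> dvd a" using less.hyps[of a] nz(1) ab(2) by blast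
    then show ?thesis unfolding ab(1) by (blast intro: dvd_mult2)
  qed
qed

text \<open>The exponent of a prime \<open>\<pi>\<close> in \<open>x\<close>; for \<open>x = 0\<close> it has no meaning.\<close>
definition vord :: "'a::field poly \<Rightarrow> 'a poly \<Rightarrow> nat" where
  "vord \<pi> x = Max {k. \<pi> ^ k dvd x}"

lemma power_dvd_iff_vord:
  fixes \<pi> x :: "'a::field poly"
  assumes "prime_elem \<pi>" "x \<noteq> 0"
  shows "\<pi> ^ k dvd x \<longleftrightarrow> k \<le> vord \<pi> x"
proof -
  have deg: "degree \<pi> > 0"
    using assms(1) is_unit_iff_degree[of \<pi>] by (auto simp: prime_elem_def)
  have bound: "k \<le> degree x" if "\<pi> ^ k dvd x" for k
  proof -
    have "k * degree \<pi> \<le> degree x"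
      using dvd_imp_degree_le[OF that assms(2)] assms(1) by (simp add: degree_power_eq)
    moreover have "k * 1 \<le> k * degree \<pi>" using deg by (intro mult_le_mono2) simp
    ultimately show ?thesis by linarith
  qed
  have fin: "finite {k. \<pi> ^ k dvd x}"
    by (rule finite_subset[of _ "{..degree x}"]) (use bound in auto)
  have "\<pi> ^ vord \<pi> x dvd x"
  proof -
    have "0 \<in> {k. \<pi> ^ k dvd x}" by simp
    then have "Max {k. \<pi> ^ k dvd x} \<in> {k. \<pi> ^ k dvd x}" using fin by (intro Max_in) blast+
    then show ?thesis by (simp add: vord_def)
  qed
  then show ?thesis
    using Max_ge[OF fin, of k] by (auto simp: vord_def intro: dvd_trans[OF le_imp_power_dvd])
qed

lemma vord_pos_iff:
  assumes "prime_elem \<pi>" "x \<noteq> 0"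
  shows "vord \<pi> x > 0 \<longleftrightarrow> \<pi> dvd x"
  using power_dvd_iff_vord[OF assms, of 1] by auto

lemma vord_eqI:
  assumes "prime_elem \<pi>" "x = \<pi> ^ k * y" "\<not> \<pi> dvd y"
  shows "vord \<pi> x = k"
proof -
  have nz: "x \<noteq> 0" using assms by (auto simp: prime_elem_def)
  have "k \<le> vord \<pi> x"
    using power_dvd_iff_vord[OF assms(1) nz, of k] assms(2) by simp
  moreover have "\<not> Suc k \<le> vord \<pi> x"
  proof
    assume "Suc k \<le> vord \<pi> x"
    then have "\<pi> ^ k * \<pi> dvd \<pi> ^ k * y"
      using power_dvd_iff_vord[OF assms(1) nz, of "Suc k"] assms(2) by (simp add: mult.commute)
    then show False using assms by (auto simp: prime_elem_def)
  qed
  ultimately show ?thesis by simp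
qed

lemma vord_decompose:
  assumes "prime_elem \<pi>" "x \<noteq> 0"
  obtains y where "x = \<pi> ^ vord \<pi> x * y" "\<not> \<pi> dvd y"
proof -
  obtain y where y: "x = \<pi> ^ vord \<pi> x * y"
    using power_dvd_iff_vord[OF assms, of "vord \<pi> x"] by (auto elim: dvdE)
  have "\<not> \<pi> dvd y"
  proof
    assume "\<pi> dvd y"
    then have "\<pi> ^ vord \<pi> x * \<pi> dvd \<pi> ^ vord \<pi> x * y" by (rule mult_dvd_mono[OF dvd_refl])
    then have "\<pi> ^ Suc (vord \<pi> x) dvd x"
      by (simp only: y[symmetric] power_Suc2)
    then show False using power_dvd_iff_vord[OF assms, of "Suc (vord \<pi> x)"] by simp
  qed
  with y that show thesis by blast
qed

lemma vord_mult:
  assumes "prime_elem \<pi>" "x \<noteq> 0" "y \<noteq> 0"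
  shows "vord \<pi> (x * y) = vord \<pi> x + vord \<pi> y"
proof -
  obtain a where a: "x = \<pi> ^ vord \<pi> x * a" "\<not> \<pi> dvd a" using vord_decompose[OF assms(1,2)] .
  obtain b where b: "y = \<pi> ^ vord \<pi> y * b" "\<not> \<pi> dvd b" using vord_decompose[OF assms(1,3)] .
  have "x * y = \<pi> ^ (vord \<pi> x + vord \<pi> y) * (a * b)"
    by (subst a(1), subst b(1)) (simp add: power_add)
  moreover have "\<not> \<pi> dvd a * b" using a b assms(1) by (simp add: prime_elem_dvd_mult_iff)
  ultimately show ?thesis by (rule vord_eqI[OF assms(1)])
qed

lemma vord_one [simp]: "prime_elem \<pi> \<Longrightarrow> vord \<pi> 1 = 0"
  by (rule vord_eqI[of _ _ _ 1]) (auto simp: prime_elem_def)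

lemma vord_prod:
  assumes "prime_elem \<pi>" "\<And>x. x \<in> A \<Longrightarrow> g x \<noteq> 0"
  shows "vord \<pi> (prod g A) = (\<Sum>x\<in>A. vord \<pi> (g x))"
  using assms(2)
  by (induction A rule: infinite_finite_induct) (auto simp: assms(1) vord_mult)

lemma vord_mono:
  assumes "prime_elem \<pi>" "x dvd y" "y \<noteq> 0"
  shows "vord \<pi> x \<le> vord \<pi> y"
proof -
  obtain z where z: "y = x * z" using assms(2) by (rule dvdE)
  have "x \<noteq> 0" "z \<noteq> 0" using assms(3) unfolding z by auto
  then show ?thesis unfolding z using assms(1) by (simp add: vord_mult)
qed

text \<open>Divisibility can be tested at one prime at a time. Dividing both polynomials by their
  greatest common divisor \<open>g\<close> leaves coprime \<open>h\<close> and \<open>k\<close>, and a prime factor of \<open>h\<close> would also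
  have to divide \<open>k\<close>. The hypothesis uses a power of \<open>\<pi>\<close> rather than the valuation of \<open>y\<close> so
  that \<open>y = 0\<close> is covered.\<close>
lemma dvdI_vord:
  fixes x y :: "'a::field poly"
  assumes "x \<noteq> 0" "\<And>\<pi>. prime_elem \<pi> \<Longrightarrow> \<pi> ^ vord \<pi> x dvd y"
  shows "x dvd y"
proof -
  obtain g u v where g: "g dvd x" "g dvd y" "g = u * x + v * y" using poly_bezout by blast
  obtain h where h: "x = g * h" using g(1) by (rule dvdE)
  obtain k where k: "y = g * k" using g(2) by (rule dvdE)
  note hk = h k
  have nz: "g \<noteq> 0" "h \<noteq> 0" using assms(1) hk by auto
  have "g * 1 = g * (u * h + v * k)" using g(3) hk by (simp add: algebra_simps)
  then have one: "1 = u * h + v * k" using nz(1) by (simp only: mult_cancel_left) simp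
  have "is_unit h"
  proof (rule ccontr)
    assume "\<not> is_unit h"
    then obtain \<pi> where \<pi>: "prime_elem \<pi>" "\<pi> dvd h"
      using prime_divisor_poly_exists nz(2) by blast
    have "vord \<pi> x > vord \<pi> g"
      using \<pi> nz vord_pos_iff[of \<pi> h] by (simp add: hk vord_mult)
    have "\<pi> dvd k"
    proof (cases "k = 0")
      case False
      then have "vord \<pi> x \<le> vord \<pi> (g * k)"
        using assms(2)[OF \<pi>(1)] nz hk \<pi>(1) power_dvd_iff_vord[of \<pi> y "vord \<pi> x"] by simp
      then have "vord \<pi> k > 0" using \<open>vord \<pi> x > vord \<pi> g\<close> False nz \<pi>(1) by (simp add: vord_mult)
      then show ?thesis using vord_pos_iff False \<pi>(1) by blast
    qed simp
    then have "\<pi> dvd 1" using \<pi>(2) by (subst one) (intro dvd_add dvd_mult)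
    then show False using \<pi>(1) by (auto simp: prime_elem_def)
  qed
  then show ?thesis using hk by (simp add: unit_imp_dvd)
qed

lemma dvdI_vord_le:
  fixes x y :: "'a::field poly"
  assumes "x \<noteq> 0" "y \<noteq> 0" "\<And>\<pi>. prime_elem \<pi> \<Longrightarrow> vord \<pi> x \<le> vord \<pi> y"
  shows "x dvd y"
proof (rule dvdI_vord[OF assms(1)])
  show "\<pi> ^ vord \<pi> x dvd y" if "prime_elem \<pi>" for \<pi>
    using power_dvd_iff_vord[OF that assms(2)] assms(3)[OF that] by simp
qed

text \<open>The ultrametric principle: a difference of larger valuation does not change the
  valuation.\<close>
lemma vord_eq_if_diff:
  assumes "prime_elem \<pi>" "x \<noteq> 0" "y \<noteq> 0" "\<pi> ^ Suc (vord \<pi> x) dvd y - x"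
  shows "vord \<pi> y = vord \<pi> x"
proof -
  obtain a where a: "x = \<pi> ^ vord \<pi> x * a" "\<not> \<pi> dvd a" using vord_decompose[OF assms(1,2)] .
  obtain w where w: "y - x = \<pi> ^ Suc (vord \<pi> x) * w" using assms(4) by (auto elim: dvdE)
  have "y = \<pi> ^ vord \<pi> x * (a + \<pi> * w)"
    using a(1) w by (simp add: algebra_simps)
  moreover have "\<not> \<pi> dvd a + \<pi> * w" using a(2) by (simp add: dvd_add_left_iff)
  ultimately show ?thesis by (rule vord_eqI[OF assms(1)])
qed

text \<open>Taylor expansion to first order, with a polynomial remainder so that it holds in every
  characteristic.\<close>
lemma pcompose_taylor:
  fixes f a b :: "'a::idom poly"
  shows "\<exists>w. pcompose f a - pcompose f b = (a - b) * (pcompose (pderiv f) b + (a - b) * w)"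
proof (induction f rule: pCons_induct)
  case 0
  then show ?case by (auto intro: exI[of _ 0])
next
  case (pCons c f)
  then obtain w where w: "pcompose f a - pcompose f b = (a - b) * (pcompose (pderiv f) b + (a - b) * w)"
    by blast
  let ?D = "pcompose (pderiv f) b"
  have 1: "pcompose f a = pcompose f b + (a - b) * (?D + (a - b) * w)" using w by (simp add: algebra_simps)
  have 2: "pcompose (pderiv (pCons c f)) b = pcompose f b + b * ?D"
    by (simp add: pderiv_pCons pcompose_add pcompose_pCons)
  have "a * pcompose f a - b * pcompose f b
          = (a - b) * (pcompose f b + b * ?D + (a - b) * (?D + a * w))"
    unfolding 1 by (simp add: algebra_simps)
  then show ?case unfolding 2 by (auto simp: pcompose_pCons)
qed

lemma dvd_pcompose_diff:
  fixes f a b :: "'a::idom poly"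
  assumes "q dvd a - b"
  shows "q dvd pcompose f a - pcompose f b"
  using pcompose_taylor[of f a b] assms by auto

lemma pcompose_dvd_mono: "p dvd q \<Longrightarrow> pcompose p z dvd pcompose q (z :: 'a::comm_ring_1 poly)"
  by (elim dvdE) (simp add: pcompose_mult)

section \<open>Differences along the orbit of \<open>x\<close>\<close>

lemma poly_iterate_0 [simp]: "poly_iterate f 0 = [:0, 1:]"
  by (simp add: poly_iterate_def)

lemma poly_iterate_Suc: "poly_iterate f (Suc k) = pcompose f (poly_iterate f k)"
  by (simp add: poly_iterate_def)

lemma poly_iterate_add: "pcompose (poly_iterate f j) (poly_iterate f i) = poly_iterate f (i + j)"
  by (induction j) (simp_all add: poly_iterate_Suc pcompose_pCons flip: pcompose_assoc)

lemma degree_poly_iterate: "degree (poly_iterate f k) = degree f ^ k"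
  by (induction k) (simp_all add: poly_iterate_Suc degree_pcompose)

text \<open>For \<open>i = 0\<close> this is \<open>f\<^sup>j(x) - x\<close>, the factor from which dynatomic polynomials are built;
  for general \<open>i\<close> it is that factor evaluated at \<open>f\<^sup>i(x)\<close>. Generalized dynatomic polynomials
  need both indices.\<close>
definition orbit_diff :: "'a::field poly \<Rightarrow> nat \<Rightarrow> nat \<Rightarrow> 'a poly" where
  "orbit_diff f i j = poly_iterate f (i + j) - poly_iterate f i"

lemma pcompose_orbit_diff:
  "pcompose (orbit_diff f i j) (poly_iterate f k) = orbit_diff f (k + i) j"
  by (simp add: orbit_diff_def pcompose_diff poly_iterate_add add.assoc)

lemma orbit_diff_nonzero:
  assumes "degree f \<ge> 2" "j > 0"
  shows "orbit_diff f i j \<noteq> 0"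
proof
  assume "orbit_diff f i j = 0"
  then have "degree f ^ (i + j) = degree f ^ i"
    using degree_poly_iterate by (metis orbit_diff_def right_minus_eq)
  then show False using assms by (subst (asm) power_inject_exp) auto
qed

lemma dvd_iterate_shift:
  assumes "q dvd poly_iterate f a - poly_iterate f b"
  shows "q dvd poly_iterate f (a + t) - poly_iterate f (b + t)"
  by (induction t) (simp_all add: assms poly_iterate_Suc dvd_pcompose_diff)

text \<open>Modulo \<open>q\<close> the orbit of \<open>x\<close> under \<open>f\<close> is periodic of period \<open>n\<close> from index \<open>i\<close> on. The
  reason is that \<open>f\<close>, being a polynomial, respects congruences.\<close>
lemma dvd_iterate_diff_if_cong:
  assumes q: "q dvd orbit_diff f i n" and "i \<le> a" "i \<le> b" "a mod n = b mod n"
  shows "q dvd poly_iterate f a - poly_iterate f b"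
proof -
  have up: "q dvd poly_iterate f (s + n * t) - poly_iterate f s" if "i \<le> s" for s t
  proof (induction t)
    case (Suc t)
    have "q dvd poly_iterate f ((i + n) + (s + n * t - i)) - poly_iterate f (i + (s + n * t - i))"
      by (rule dvd_iterate_shift) (use q in \<open>simp add: orbit_diff_def\<close>)
    then have "q dvd poly_iterate f (s + n * Suc t) - poly_iterate f (s + n * t)"
      using that by (simp add: algebra_simps)
    from dvd_add[OF this Suc] show ?case by simp
  qed simp
  have *: "q dvd poly_iterate f a - poly_iterate f b" if "i \<le> b" "b \<le> a" "a mod n = b mod n" for a b
  proof -
    have "n dvd a - b" using mod_eq_dvd_iff_nat[OF that(2)] that(3) by simp
    then obtain t where "a - b = n * t" by (rule dvdE)
    then have "a = b + n * t" using that(2) by simp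
    then show ?thesis using up[OF that(1)] by simp
  qed
  show ?thesis
  proof (cases "b \<le> a")
    case True
    then show ?thesis using * assms by simp
  next
    case False
    then show ?thesis using *[of a b] assms by (subst dvd_diff_commute) simp
  qed
qed

lemma orbit_diff_dvd_orbit_diff:
  assumes "i \<le> s" "n dvd j"
  shows "orbit_diff f i n dvd orbit_diff f s j"
  using dvd_iterate_diff_if_cong[OF dvd_refl, where f = f and i = i and n = n and a = "s + j" and b = s] assms
  by (auto simp: orbit_diff_def elim!: dvdE)

text \<open>The orbit differences with fixed \<open>i\<close> form a strong divisibility sequence: the periods of
  an orbit are closed under greatest common divisors, by Bezout.\<close>
lemma dvd_orbit_diff_gcd_iff:
  assumes "j > 0"
  shows "q dvd orbit_diff f i (gcd j k) \<longleftrightarrow> q dvd orbit_diff f i j \<and> q dvd orbit_diff f i k"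
proof
  show "q dvd orbit_diff f i j \<and> q dvd orbit_diff f i k" if "q dvd orbit_diff f i (gcd j k)"
    using that by (meson dvd_trans gcd_dvd1 gcd_dvd2 order_refl orbit_diff_dvd_orbit_diff)
next
  assume q: "q dvd orbit_diff f i j \<and> q dvd orbit_diff f i k"
  obtain x y where xy: "j * x = k * y + gcd j k" using bezout_nat[of j k] assms by auto
  have 1: "q dvd poly_iterate f (i + j * x) - poly_iterate f i"
    by (rule dvd_iterate_diff_if_cong[of _ _ i j]) (use q in auto)
  have 2: "q dvd poly_iterate f (i + gcd j k + k * y) - poly_iterate f (i + gcd j k)"
    by (rule dvd_iterate_diff_if_cong[of _ _ i k]) (use q in auto)
  from dvd_diff[OF 1 2] show "q dvd orbit_diff f i (gcd j k)"
    by (simp add: orbit_diff_def xy algebra_simps)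
qed

lemma vord_orbit_diff_gcd:
  assumes "degree f \<ge> 2" "prime_elem \<pi>" "j > 0" "k > 0"
  shows "vord \<pi> (orbit_diff f i (gcd j k)) = min (vord \<pi> (orbit_diff f i j)) (vord \<pi> (orbit_diff f i k))"
proof -
  have "t \<le> vord \<pi> (orbit_diff f i (gcd j k)) \<longleftrightarrow>
        t \<le> min (vord \<pi> (orbit_diff f i j)) (vord \<pi> (orbit_diff f i k))" for t
    using dvd_orbit_diff_gcd_iff[of j "\<pi> ^ t" f i k] assms
    by (simp add: power_dvd_iff_vord orbit_diff_nonzero)
  then show ?thesis by (meson order_antisym order_refl)
qed

lemma vord_orbit_diff_mono:
  assumes "degree f \<ge> 2" "prime_elem \<pi>" "i \<le> s" "n dvd j" "j > 0"
  shows "vord \<pi> (orbit_diff f i n) \<le> vord \<pi> (orbit_diff f s j)"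
  using assms by (intro vord_mono orbit_diff_dvd_orbit_diff orbit_diff_nonzero)

section \<open>Moebius sums over strong divisibility sequences\<close>

text \<open>Zero is included so that the value is defined for \<open>n = 1\<close>, which has no proper divisor;
  there the valuation of the first dynatomic polynomial is that of \<open>f(x) - x\<close>, with nothing
  subtracted.\<close>
definition divisor_max :: "(nat \<Rightarrow> nat) \<Rightarrow> nat \<Rightarrow> nat" where
  "divisor_max w n = Max (insert 0 (w ` {h. h dvd n \<and> h < n}))"

lemma divisor_max_ge: "h dvd n \<Longrightarrow> h < n \<Longrightarrow> w h \<le> divisor_max w n"
  by (simp add: divisor_max_def)

lemma divisor_max_leI:
  assumes "\<And>h. h dvd n \<Longrightarrow> h < n \<Longrightarrow> w h \<le> b"
  shows "divisor_max w n \<le> b"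
  using assms by (auto simp: divisor_max_def)

lemma div_pos_if_dvd: "e dvd d \<Longrightarrow> d > 0 \<Longrightarrow> d div e > (0::nat)"
  by (auto simp: div_greater_zero_iff dvd_imp_le intro: dvd_pos_nat)

lemma moebius_mu_mult_prime:
  assumes "prime p" "\<not> p dvd e" "squarefree e"
  shows "squarefree (p * e)" "moebius_mu (p * e) = - moebius_mu e"
proof -
  have cop: "coprime p e" using assms by (simp add: prime_imp_coprime)
  then show sf: "squarefree (p * e)"
    by (rule squarefree_mult_coprime) (use assms in \<open>auto intro: squarefree_prime\<close>)
  have "e \<noteq> 0" using assms(2) by (cases e) auto
  then have "prime_factors (p * e) = insert p (prime_factors e)"
    using assms(1) by (subst prime_factorization_mult) (auto simp: prime_factorization_prime)
  moreover have "p \<notin> prime_factors e" using assms(2) by auto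
  ultimately show "moebius_mu (p * e) = - moebius_mu e"
    using sf assms(3) by (simp add: moebius_mu_def)
qed

lemma moebius_mu_1 [simp]: "moebius_mu (Suc 0) = 1"
  by (simp add: moebius_mu_def)

text \<open>Inclusion-exclusion for the maximum over proper divisors. Pick a prime \<open>p\<close> dividing \<open>n\<close>
  for which \<open>w (n div p)\<close> is largest and pair each squarefree \<open>e\<close> prime to \<open>p\<close> with \<open>p * e\<close>. For
  \<open>e \<noteq> 1\<close> the two terms cancel, because
  \<open>w (n div (p * e)) = min (w (n div p)) (w (n div e)) = w (n div e)\<close>. Only \<open>w n - w (n div p)\<close>
  survives.\<close>
lemma moebius_sum_strong_divisibility:
  fixes w :: "nat \<Rightarrow> nat"
  assumes n: "n > 0"
    and w: "\<And>j k. j dvd n \<Longrightarrow> k dvd n \<Longrightarrow> w (gcd j k) = min (w j) (w k)"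
  shows "(\<Sum>e | e dvd n. moebius_mu e * int (w (n div e))) = int (w n) - int (divisor_max w n)"
proof (cases "n = 1")
  case True
  then have 1: "{e. e dvd n} = {Suc 0}" and 2: "{h. h dvd n \<and> h < n} = {}" by auto
  have "divisor_max w n = 0" unfolding divisor_max_def 2 by simp
  then show ?thesis unfolding 1 by simp
next
  case False
  have mono: "w j \<le> w k" if "j dvd k" "k dvd n" for j k
    using w[of j k] that by (metis dvd_trans gcd_nat.absorb1 min.cobounded2)
  have "prime_factors n \<noteq> {}" using n False by (simp add: prime_factorization_empty_iff)
  then have "Max ((\<lambda>q. w (n div q)) ` prime_factors n) \<in> (\<lambda>q. w (n div q)) ` prime_factors n"
    by (intro Max_in) auto
  \<comment> \<open>Any prime \<open>p\<close> for which \<open>w (n div p)\<close> is largest makes the pairing of \<open>e\<close> with \<open>p * e\<close>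
    work.\<close>
  then obtain p where p: "p \<in> prime_factors n" "w (n div p) = Max ((\<lambda>q. w (n div q)) ` prime_factors n)"
    by auto
  have pmax: "w (n div q) \<le> w (n div p)" if "q \<in> prime_factors n" for q
    unfolding p(2) using that by (intro Max_ge) auto
  have pp: "prime p" "p dvd n" using p(1) by auto
  have top: "w h \<le> w (n div p)" if h: "h dvd n" "h < n" for h
  proof -
    obtain r where r: "n = h * r" using h(1) by (auto elim: dvdE)
    have "r \<noteq> 1" using r h by auto
    then obtain q where q: "prime q" "q dvd r" using prime_factor_nat by blast
    then obtain s where s: "r = q * s" by (auto elim: dvdE)
    have "q \<in> prime_factors n" using q r n by (simp add: prime_factors_dvd)
    moreover have "n div q = h * s" using q(1) by (simp add: r s prime_gt_0_nat mult.left_commute)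
    ultimately show ?thesis
      using pmax[of q] mono[of h "h * s"] r s by (auto intro: order_trans)
  qed
  have dmax: "divisor_max w n = w (n div p)"
  proof (rule antisym)
    show "divisor_max w n \<le> w (n div p)" by (rule divisor_max_leI) (rule top)
    have "n div p < n" using pp(1) n prime_gt_1_nat by (intro div_less_dividend) auto
    then show "w (n div p) \<le> divisor_max w n" using pp(2) by (intro divisor_max_ge) auto
  qed
  define A where "A = {e. e dvd n \<and> squarefree e \<and> \<not> p dvd e}"
  have finA: "finite A" using n by (auto simp: A_def)
  have inj: "inj_on ((*) p) A" using pp(1) by (auto intro!: inj_onI simp: prime_gt_0_nat)
  have D: "{e. e dvd n \<and> squarefree e} = A \<union> (*) p ` A"
  proof (intro equalityI subsetI)
    \<comment> \<open>A squarefree divisor contains the chosen prime \<open>p\<close> at most once.\<close>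
    fix e assume e: "e \<in> {e. e dvd n \<and> squarefree e}"
    show "e \<in> A \<union> (*) p ` A"
    proof (cases "p dvd e")
      case True
      then obtain r where r: "e = p * r" by (auto elim: dvdE)
      have "\<not> p dvd r"
      proof
        assume "p dvd r"
        then have "p ^ 2 dvd e" by (auto simp: r power2_eq_square)
        then show False using e pp(1) by (auto dest!: squarefreeD)
      qed
      then have "r \<in> A" using e unfolding A_def r
        by (auto intro: squarefree_mono[of r "p * r"] dvd_trans[of r "p * r"])
      then show ?thesis by (auto simp: r)
    qed (use e in \<open>auto simp: A_def\<close>)
  next
    fix e assume "e \<in> A \<union> (*) p ` A"
    then show "e \<in> {e. e dvd n \<and> squarefree e}"
      using pp by (auto simp: A_def intro!: moebius_mu_mult_prime divides_mult prime_imp_coprime)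
  qed
  have "(\<Sum>e | e dvd n. moebius_mu e * int (w (n div e)))
      = (\<Sum>e | e dvd n \<and> squarefree e. moebius_mu e * int (w (n div e)))"
    using n by (intro sum.mono_neutral_right) (auto simp: moebius_mu_def)
  also have "\<dots> = (\<Sum>e\<in>A. moebius_mu e * int (w (n div e)))
                + (\<Sum>e\<in>A. moebius_mu (p * e) * int (w (n div (p * e))))"
    unfolding D using finA inj by (subst sum.union_disjoint) (auto simp: A_def sum.reindex)
  also have "\<dots> = (\<Sum>e\<in>A. moebius_mu e * (int (w (n div e)) - int (w (n div (p * e)))))"
    unfolding sum.distrib[symmetric] using pp(1)
    by (intro sum.cong refl) (auto simp: A_def moebius_mu_mult_prime right_diff_distrib)
  also have "\<dots> = (\<Sum>e\<in>{1}. moebius_mu e * (int (w (n div e)) - int (w (n div (p * e)))))"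
  proof (rule sum.mono_neutral_right[OF finA])
    have codvd: "n div q dvd n" if "q dvd n" for q
      using that by (metis dvd_div_mult_self dvd_triv_left)
    show "{1} \<subseteq> A" using pp(1) by (auto simp: A_def)
    show "\<forall>e\<in>A - {1}. moebius_mu e * (int (w (n div e)) - int (w (n div (p * e)))) = 0"
    proof
      fix e assume e: "e \<in> A - {1}"
      then have "coprime p e" using pp(1) by (simp add: A_def prime_imp_coprime)
      then have dv: "p * e dvd n" using e pp(2) by (auto simp: A_def intro: divides_mult)
      then obtain r where r: "n = p * e * r" by (auto elim: dvdE)
      have pos: "p > 0" "e > 0" using r n by auto
      \<comment> \<open>So \<open>w (n div (p * e))\<close> is a minimum, and it is attained at \<open>n div e\<close> by the choice of
        \<open>p\<close>.\<close>
      have "gcd (n div p) (n div e) = n div (p * e)"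
        using pos \<open>coprime p e\<close> unfolding r
        by (simp add: mult.assoc mult.left_commute[of p e r] gcd_mult_right_right_cancel)
           (metis coprime_commute coprime_imp_gcd_eq_1 gcd_mult_distrib_nat mult.commute mult.right_neutral)
      then have "w (n div (p * e)) = min (w (n div p)) (w (n div e))"
        using w[of "n div p" "n div e"] codvd[OF pp(2)] codvd[of e] e by (simp add: A_def)
      moreover have "w (n div e) \<le> w (n div p)"
      proof (rule top)
        show "n div e dvd n" using e by (auto simp: A_def)
        show "n div e < n" using e pos n by (intro div_less_dividend) auto
      qed
      ultimately show "moebius_mu e * (int (w (n div e)) - int (w (n div (p * e)))) = 0" by simp
    qed
  qed
  also have "\<dots> = int (w n) - int (divisor_max w n)" by (simp add: dmax)
  finally show ?thesis .
qed

text \<open>The constant function \<open>1\<close> is a trivial strong divisibility sequence.\<close>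
lemma moebius_sum_eq_0:
  assumes "n > 1"
  shows "(\<Sum>e | e dvd n. moebius_mu e) = 0"
proof -
  have "(1::nat) \<le> divisor_max (\<lambda>_. 1) n" "divisor_max (\<lambda>_. 1) n \<le> 1"
    using assms by (auto intro!: divisor_max_ge[of 1 n "\<lambda>_. 1", simplified] divisor_max_leI)
  then show ?thesis
    using moebius_sum_strong_divisibility[of n "\<lambda>_. 1"] assms by simp
qed

section \<open>Dynatomic polynomials are polynomials\<close>

lemma moebius_mu_cases:
  obtains "moebius_mu e = 1" | "moebius_mu e = -1" | "moebius_mu e = 0"
proof -
  have "moebius_mu e \<in> {1, -1, 0}" by (auto simp: moebius_mu_def minus_one_power_iff)
  then show thesis using that by auto
qed

lemma poly_of_fract_to_fract [simp]: "poly_of_fract (to_fract p) = p"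
  by (simp add: poly_of_fract_def)

lemma to_fract_prod: "to_fract (prod g A) = (\<Prod>x\<in>A. to_fract (g x))"
  by (induction A rule: infinite_finite_induct) auto

text \<open>The parts for \<open>s = 1\<close> and \<open>s = -1\<close> are numerator and denominator of the product that
  defines the \<open>n\<close>th dynatomic polynomial, evaluated at \<open>f\<^sup>i(x)\<close>.\<close>
definition moebius_part :: "int \<Rightarrow> 'a::field poly \<Rightarrow> nat \<Rightarrow> nat \<Rightarrow> 'a poly" where
  "moebius_part s f i n =
     (\<Prod>e | e dvd n. if moebius_mu e = s then orbit_diff f i (n div e) else 1)"

lemma pcompose_moebius_part:
  "pcompose (moebius_part s f 0 n) (poly_iterate f i) = moebius_part s f i n"
  by (auto simp: moebius_part_def pcompose_prod pcompose_orbit_diff pcompose_1 intro!: prod.cong)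

lemma moebius_part_nonzero:
  assumes "degree f \<ge> 2" "n > 0"
  shows "moebius_part s f i n \<noteq> 0"
  using assms by (auto simp: moebius_part_def orbit_diff_nonzero)

lemma moebius_prod_conv_parts:
  "(\<Prod>e | e dvd n. to_fract (orbit_diff f i (n div e)) powi moebius_mu e)
     = to_fract (moebius_part 1 f i n) / to_fract (moebius_part (-1) f i n)"
proof -
  have "to_fract (orbit_diff f i (n div e)) powi moebius_mu e
     = to_fract (if moebius_mu e = 1 then orbit_diff f i (n div e) else 1)
       / to_fract (if moebius_mu e = -1 then orbit_diff f i (n div e) else 1)" for e
    by (cases e rule: moebius_mu_cases) (auto simp: power_int_minus_divide)
  then show ?thesis
    by (simp only: moebius_part_def to_fract_prod prod_dividef)
qed

lemma vord_moebius_parts: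
  assumes "degree f \<ge> 2" "n > 0" "prime_elem \<pi>"
  shows "int (vord \<pi> (moebius_part 1 f i n)) - int (vord \<pi> (moebius_part (-1) f i n))
       = int (vord \<pi> (orbit_diff f i n)) - int (divisor_max (\<lambda>j. vord \<pi> (orbit_diff f i j)) n)"
proof -
  have ord: "int (vord \<pi> (moebius_part s f i n))
      = (\<Sum>e | e dvd n. if moebius_mu e = s then int (vord \<pi> (orbit_diff f i (n div e))) else 0)" for s
    unfolding moebius_part_def using assms
    by (subst vord_prod) (auto simp: orbit_diff_nonzero intro!: sum.cong)
  have "int (vord \<pi> (moebius_part 1 f i n)) - int (vord \<pi> (moebius_part (-1) f i n))
      = (\<Sum>e | e dvd n. moebius_mu e * int (vord \<pi> (orbit_diff f i (n div e))))"
    unfolding ord sum_subtractf[symmetric]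
  proof (intro sum.cong refl)
    show "(if moebius_mu e = 1 then int (vord \<pi> (orbit_diff f i (n div e))) else 0)
        - (if moebius_mu e = -1 then int (vord \<pi> (orbit_diff f i (n div e))) else 0)
        = moebius_mu e * int (vord \<pi> (orbit_diff f i (n div e)))" for e
      by (cases e rule: moebius_mu_cases) auto
  qed
  also have "\<dots> = int (vord \<pi> (orbit_diff f i n))
      - int (divisor_max (\<lambda>j. vord \<pi> (orbit_diff f i j)) n)"
  proof (rule moebius_sum_strong_divisibility[OF assms(2)])
    fix j k assume "j dvd n" "k dvd n"
    then have "j > 0" "k > 0" using assms(2) by (auto intro: dvd_pos_nat)
    then show "vord \<pi> (orbit_diff f i (gcd j k))
        = min (vord \<pi> (orbit_diff f i j)) (vord \<pi> (orbit_diff f i k))"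
      using assms by (intro vord_orbit_diff_gcd)
  qed
  finally show ?thesis .
qed

lemma divisor_max_vord_le:
  assumes "degree f \<ge> 2" "n > 0" "prime_elem \<pi>"
  shows "divisor_max (\<lambda>j. vord \<pi> (orbit_diff f i j)) n \<le> vord \<pi> (orbit_diff f i n)"
  using assms by (intro divisor_max_leI vord_orbit_diff_mono order_refl)

text \<open>Polynomiality of the defining product. By the Moebius sum above, its valuation at every
  prime is a difference between \<open>vord \<pi> (orbit_diff f 0 n)\<close> and the largest such valuation for a
  proper divisor of \<open>n\<close>, hence not negative. In other words, the \<open>n\<close>th dynatomic polynomial is
  the quotient of \<open>f\<^sup>n(x) - x\<close> by the least common multiple of its proper relatives.\<close>
lemma dynatomic_mult_moebius_part:
  assumes "degree f \<ge> 2" "n > 0"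
  shows "dynatomic f n * moebius_part (-1) f 0 n = moebius_part 1 f 0 n"
proof -
  note nz = moebius_part_nonzero[OF assms]
  have "moebius_part (-1) f 0 n dvd moebius_part 1 f 0 n"
  proof (rule dvdI_vord_le[OF nz nz])
    fix \<pi> :: "'a poly" assume \<pi>: "prime_elem \<pi>"
    show "vord \<pi> (moebius_part (-1) f 0 n) \<le> vord \<pi> (moebius_part 1 f 0 n)"
      using vord_moebius_parts[OF assms \<pi>, of 0] divisor_max_vord_le[OF assms \<pi>, of 0] by linarith
  qed
  then obtain p where p: "moebius_part 1 f 0 n = moebius_part (-1) f 0 n * p" by (rule dvdE)
  have "dynatomic f n = poly_of_fract
     (\<Prod>e | e dvd n. to_fract (orbit_diff f 0 (n div e)) powi moebius_mu e)"
    by (simp add: dynatomic_def orbit_diff_def)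
  also have "\<dots> = poly_of_fract (to_fract p)"
    unfolding moebius_prod_conv_parts p using nz[of "-1" 0] by simp
  finally show ?thesis by (simp add: p mult.commute)
qed

abbreviation dynatomic_iterate :: "'a::field poly \<Rightarrow> nat \<Rightarrow> nat \<Rightarrow> 'a poly" where
  "dynatomic_iterate f i n \<equiv> pcompose (dynatomic f n) (poly_iterate f i)"

lemma dynatomic_iterate_mult_moebius_part:
  assumes "degree f \<ge> 2" "n > 0"
  shows "dynatomic_iterate f i n * moebius_part (-1) f i n = moebius_part 1 f i n"
  using arg_cong[OF dynatomic_mult_moebius_part[OF assms], of "\<lambda>p. pcompose p (poly_iterate f i)"]
  by (simp add: pcompose_mult pcompose_moebius_part)

lemma dynatomic_iterate_nonzero:
  assumes "degree f \<ge> 2" "n > 0"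
  shows "dynatomic_iterate f i n \<noteq> 0"
  using dynatomic_iterate_mult_moebius_part[OF assms, of i] moebius_part_nonzero[OF assms, of 1 i]
  by auto

lemma to_fract_dynatomic_iterate:
  assumes "degree f \<ge> 2" "n > 0"
  shows "to_fract (dynatomic_iterate f i n)
       = (\<Prod>e | e dvd n. to_fract (orbit_diff f i (n div e)) powi moebius_mu e)"
  unfolding moebius_prod_conv_parts dynatomic_iterate_mult_moebius_part[OF assms, symmetric]
  using moebius_part_nonzero[OF assms, of "-1" i] by simp

lemma vord_dynatomic_iterate:
  assumes "degree f \<ge> 2" "n > 0" "prime_elem \<pi>"
  shows "vord \<pi> (dynatomic_iterate f i n) + divisor_max (\<lambda>j. vord \<pi> (orbit_diff f i j)) n
       = vord \<pi> (orbit_diff f i n)"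
proof -
  have "vord \<pi> (moebius_part 1 f i n)
      = vord \<pi> (dynatomic_iterate f i n) + vord \<pi> (moebius_part (-1) f i n)"
    unfolding dynatomic_iterate_mult_moebius_part[OF assms(1,2), symmetric]
    using assms by (intro vord_mult dynatomic_iterate_nonzero moebius_part_nonzero)
  then show ?thesis using vord_moebius_parts[OF assms, of i] by linarith
qed

lemma dynatomic_iterate_dvd_orbit_diff:
  assumes "degree f \<ge> 2" "n > 0"
  shows "dynatomic_iterate f i n dvd orbit_diff f i n"
proof (rule dvdI_vord_le)
  show "vord \<pi> (dynatomic_iterate f i n) \<le> vord \<pi> (orbit_diff f i n)" if "prime_elem \<pi>" for \<pi>
    using vord_dynatomic_iterate[OF assms that, of i] by linarith
qed (use assms in \<open>auto simp: dynatomic_iterate_nonzero orbit_diff_nonzero\<close>)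

lemma orbit_diff_Suc:
  "\<exists>G. orbit_diff f (Suc i) j = orbit_diff f i j * G
     \<and> orbit_diff f i j dvd G - pcompose (pderiv f) (poly_iterate f i)"
proof -
  obtain w where "pcompose f (poly_iterate f (i + j)) - pcompose f (poly_iterate f i)
      = orbit_diff f i j * (pcompose (pderiv f) (poly_iterate f i) + orbit_diff f i j * w)"
    unfolding orbit_diff_def using pcompose_taylor by blast
  then show ?thesis
    by (intro exI[of _ "pcompose (pderiv f) (poly_iterate f i) + orbit_diff f i j * w"])
       (simp add: orbit_diff_def poly_iterate_Suc)
qed

text \<open>One more application of \<open>f\<close> multiplies a difference of two \<open>\<pi>\<close>-adically close points by
  the derivative of \<open>f\<close>, up to terms divisible by \<open>\<pi>\<close>.\<close>
lemma vord_orbit_diff_Suc_eq_iff: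
  assumes "degree f \<ge> 2" "prime_elem \<pi>" "j > 0" "\<pi> dvd orbit_diff f i j"
  shows "vord \<pi> (orbit_diff f (Suc i) j) = vord \<pi> (orbit_diff f i j)
     \<longleftrightarrow> \<not> \<pi> dvd pcompose (pderiv f) (poly_iterate f i)"
proof -
  obtain G where G: "orbit_diff f (Suc i) j = orbit_diff f i j * G"
      "orbit_diff f i j dvd G - pcompose (pderiv f) (poly_iterate f i)"
    using orbit_diff_Suc by blast
  have nz: "orbit_diff f i j \<noteq> 0" "orbit_diff f (Suc i) j \<noteq> 0"
    using assms by (auto simp: orbit_diff_nonzero)
  \<comment> \<open>The quotient \<open>G\<close> is congruent to the derivative, so \<open>\<pi>\<close> divides both or neither.\<close>
  have "\<pi> dvd G - pcompose (pderiv f) (poly_iterate f i)" using G(2) assms(4) by (rule dvd_trans[rotated])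
  then have "\<pi> dvd G \<longleftrightarrow> \<pi> dvd pcompose (pderiv f) (poly_iterate f i)"
    using dvd_diff_right_iff dvd_add_right_iff
    by (metis diff_add_cancel)
  moreover have "G \<noteq> 0" using nz G(1) by auto
  ultimately show ?thesis
    using vord_mult[OF assms(2) nz(1), of G] vord_pos_iff[OF assms(2), of G] G(1) by auto
qed

text \<open>If \<open>f\<^sup>i(x)\<close> is periodic modulo \<open>q\<close>, any period found later along its orbit is already a
  period of \<open>f\<^sup>i(x)\<close> itself.\<close>
lemma dvd_orbit_diff_periodic:
  assumes "q dvd orbit_diff f i n" "n > 0" "q dvd orbit_diff f t h" "i \<le> t"
  shows "q dvd orbit_diff f i h"
proof -
  \<comment> \<open>Travel \<open>n * t\<close> steps along the cycle, which leads past \<open>t\<close> and back to the starting point.\<close>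
  have "n * t \<ge> t" using assms(2) by simp
  have "q dvd poly_iterate f (i + h) - poly_iterate f (i + n * t + h)"
    by (rule dvd_iterate_diff_if_cong[OF assms(1)]) (auto simp: add.assoc add.left_commute[of i])
  moreover have "q dvd poly_iterate f (t + h + (i + n * t - t)) - poly_iterate f (t + (i + n * t - t))"
    by (rule dvd_iterate_shift) (use assms(3) in \<open>simp add: orbit_diff_def\<close>)
  then have "q dvd poly_iterate f (i + n * t + h) - poly_iterate f (i + n * t)"
    using \<open>n * t \<ge> t\<close> by (simp add: algebra_simps)
  moreover have "q dvd poly_iterate f (i + n * t) - poly_iterate f i"
    by (rule dvd_iterate_diff_if_cong[OF assms(1)]) auto
  ultimately have "q dvd (poly_iterate f (i + h) - poly_iterate f (i + n * t + h))
     + ((poly_iterate f (i + n * t + h) - poly_iterate f (i + n * t))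
     + (poly_iterate f (i + n * t) - poly_iterate f i))" by (intro dvd_add)
  then show ?thesis by (simp add: orbit_diff_def)
qed

text \<open>If the derivative of \<open>f\<close> vanishes at a point, so does the derivative of every iterate, and
  \<open>f\<^sup>j(x) - x\<close> has derivative \<open>-1\<close> there. Hence it has no multiple zero at the point.\<close>
lemma superattracting_orbit_diff_simple:
  assumes "degree f \<ge> 2" "prime_elem \<pi>" "\<pi> dvd pderiv f" "j > 0"
  shows "vord \<pi> (orbit_diff f 0 j) \<le> 1"
proof (rule ccontr)
  assume "\<not> ?thesis"
  then have "\<pi> ^ 2 dvd orbit_diff f 0 j"
    using assms by (simp add: power_dvd_iff_vord orbit_diff_nonzero)
  then obtain w where w: "orbit_diff f 0 j = \<pi> ^ 2 * w" by (rule dvdE)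
  have "pderiv (orbit_diff f 0 j) = \<pi> * (\<pi> * pderiv w + 2 * w * pderiv \<pi>)"
    unfolding w by (simp add: pderiv_mult power2_eq_square algebra_simps)
  then have 1: "\<pi> dvd pderiv (orbit_diff f 0 j)" by simp
  obtain k where k: "j = Suc k" using assms(4) by (cases j) auto
  have "poly_iterate f j = pcompose (poly_iterate f k) f"
    using poly_iterate_add[of f k 1] by (simp add: k poly_iterate_Suc pcompose_pCons)
  then have "\<pi> dvd pderiv (poly_iterate f j)" using assms(3) by (simp add: pderiv_pcompose)
  from dvd_diff[OF this 1] have "\<pi> dvd 1"
    by (simp add: orbit_diff_def pderiv_diff pderiv_pCons flip: one_pCons)
  then show False using assms(2) by (auto simp: prime_elem_def)
qed

text \<open>This is what makes the generalized dynatomic polynomials polynomials. Fix a prime \<open>\<pi>\<close> at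
  which \<open>x\<close> is periodic. If the derivative of \<open>f\<close> is a unit at \<open>\<pi>\<close>, passing from \<open>x\<close> to \<open>f(x)\<close>
  preserves all valuations involved. If it is not, every \<open>f\<^sup>j(x) - x\<close> with \<open>j > 0\<close> has valuation
  at most one, so that \<open>\<pi>\<close> divides the dynatomic polynomial only if \<open>n\<close> is the exact period of
  \<open>x\<close>; then \<open>n\<close> is also the exact period of \<open>f(x)\<close>.\<close>
lemma dynatomic_dvd_dynatomic_iterate_1:
  assumes f: "degree f \<ge> 2" and n: "n > 0"
  shows "dynatomic_iterate f 0 n dvd dynatomic_iterate f 1 n"
proof (rule dvdI_vord_le)
  fix \<pi> :: "'a poly" assume \<pi>: "prime_elem \<pi>"
  define w where "w i j = vord \<pi> (orbit_diff f i j)" for i j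
  note od_nz = orbit_diff_nonzero[OF f]
  have V: "vord \<pi> (dynatomic_iterate f i n) + divisor_max (w i) n = w i n" for i
    using vord_dynatomic_iterate[OF f n \<pi>, of i] by (simp add: w_def[abs_def])
  have pos: "h > 0" if "h dvd n" for h using that n by (rule dvd_pos_nat[rotated])
  show "vord \<pi> (dynatomic_iterate f 0 n) \<le> vord \<pi> (dynatomic_iterate f 1 n)"
  proof (cases "w 0 n = 0")
    case True
    then show ?thesis using V[of 0] by simp
  next
    case False
    then have dn: "\<pi> dvd orbit_diff f 0 n" using vord_pos_iff[OF \<pi> od_nz[OF n]] by (simp add: w_def)
    \<comment> \<open>Since \<open>x\<close> is periodic modulo \<open>\<pi>\<close>, a period of \<open>f(x)\<close> is a period of \<open>x\<close>.\<close>
    have per: "w 1 h = 0" if "h dvd n" "w 0 h = 0" for h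
    proof (rule ccontr)
      assume "w 1 h \<noteq> 0"
      then have "\<pi> dvd orbit_diff f 1 h"
        using vord_pos_iff[OF \<pi> od_nz[OF pos[OF that(1)]]] by (simp add: w_def)
      then have "\<pi> dvd orbit_diff f 0 h" using dvd_orbit_diff_periodic[OF dn n] by blast
      then show False using that(2) vord_pos_iff[OF \<pi> od_nz[OF pos[OF that(1)]], of 0] by (simp add: w_def)
    qed
    show ?thesis
    proof (cases "\<pi> dvd pderiv f")
      case False
      have eq: "w 1 h = w 0 h" if "h dvd n" for h
      proof (cases "w 0 h = 0")
        case False
        then have "\<pi> dvd orbit_diff f 0 h"
          using vord_pos_iff[OF \<pi> od_nz[OF pos[OF that]], of 0] by (simp add: w_def)
        then show ?thesis
          using vord_orbit_diff_Suc_eq_iff[OF f \<pi> pos[OF that], of 0] \<open>\<not> \<pi> dvd pderiv f\<close>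
          by (simp add: w_def)
      qed (use per that in simp)
      then have "w 1 ` {h. h dvd n \<and> h < n} = w 0 ` {h. h dvd n \<and> h < n}"
        by (intro image_cong) auto
      then have "divisor_max (w 1) n = divisor_max (w 0) n" by (simp add: divisor_max_def)
      then show ?thesis using V[of 0] V[of 1] eq[of n] by simp
    next
      case True
      \<comment> \<open>The valuation of the dynatomic polynomial is then at most one, and it is one only if
        \<open>n\<close> is the exact period.\<close>
      have simple: "w 0 n \<le> 1"
        using superattracting_orbit_diff_simple[OF f \<pi> True n] by (simp add: w_def)
      show ?thesis
      proof (cases "divisor_max (w 0) n = 0")
        case True
        have "divisor_max (w 1) n \<le> 0"
        proof (rule divisor_max_leI)
          fix h assume h: "h dvd n" "h < n"
          then have "w 0 h = 0" using divisor_max_ge[of h n "w 0"] True by simp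
          then show "w 1 h \<le> 0" using per h(1) by simp
        qed
        moreover have "w 0 n \<le> w 1 n"
          unfolding w_def using f \<pi> n by (intro vord_orbit_diff_mono) auto
        ultimately show ?thesis using V[of 0] V[of 1] by simp
      next
        case False
        then show ?thesis using V[of 0] simple by simp
      qed
    qed
  qed
qed (use dynatomic_iterate_nonzero[OF f n] in auto)

lemma dynatomic_iterate_dvd_mono:
  assumes "degree f \<ge> 2" "n > 0" "i \<le> s"
  shows "dynatomic_iterate f i n dvd dynatomic_iterate f s n"
  using assms(3)
proof (induction s rule: dec_induct)
  case (step s)
  have "dynatomic_iterate f s n dvd dynatomic_iterate f (Suc s) n"
    using pcompose_dvd_mono[OF dynatomic_dvd_dynatomic_iterate_1[OF assms(1,2)], of "poly_iterate f s"]
    by (simp add: poly_iterate_add flip: pcompose_assoc)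
  with step.IH show ?case by (rule dvd_trans)
qed simp

lemma gen_dynatomic_Suc_mult:
  assumes "degree f \<ge> 2" "n > 0"
  shows "gen_dynatomic f (Suc m) n * dynatomic_iterate f m n = dynatomic_iterate f (Suc m) n"
proof -
  obtain p where p: "dynatomic_iterate f (Suc m) n = dynatomic_iterate f m n * p"
    using dynatomic_iterate_dvd_mono[OF assms, of m "Suc m"] by (auto elim: dvdE)
  have "gen_dynatomic f (Suc m) n = poly_of_fract (to_fract p)"
    using dynatomic_iterate_nonzero[OF assms, of m] by (simp add: p)
  then show ?thesis by (simp only: poly_of_fract_to_fract p mult.commute)
qed

lemma gen_dynatomic_dvd_dynatomic_iterate:
  assumes "degree f \<ge> 2" "n > 0"
  shows "gen_dynatomic f m n dvd dynatomic_iterate f m n"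
proof (cases m)
  case (Suc k)
  show ?thesis unfolding Suc gen_dynatomic_Suc_mult[OF assms, of k, symmetric] by (rule dvd_triv_left)
qed simp

lemma gen_dynatomic_nonzero:
  assumes "degree f \<ge> 2" "n > 0"
  shows "gen_dynatomic f m n \<noteq> 0"
  using gen_dynatomic_dvd_dynatomic_iterate[OF assms] dynatomic_iterate_nonzero[OF assms]
  by (metis dvd_0_left)

section \<open>Congruences between orbit differences\<close>

text \<open>The maxima subtracted in the valuations of the dynatomic polynomials do not decrease with
  the index. The inequality turns a zero of the generalized dynatomic polynomial into a jump
  between the valuations of consecutive orbit differences.\<close>
lemma vord_gen_dynatomic_Suc:
  assumes f: "degree f \<ge> 2" and n: "n > 0" and \<pi>: "prime_elem \<pi>"
  shows "vord \<pi> (gen_dynatomic f (Suc k) n) + vord \<pi> (orbit_diff f k n)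
       \<le> vord \<pi> (orbit_diff f (Suc k) n)"
proof -
  let ?w = "\<lambda>i j. vord \<pi> (orbit_diff f i j)"
  have "divisor_max (?w k) n \<le> divisor_max (?w (Suc k)) n"
  proof (rule divisor_max_leI)
    fix h assume h: "h dvd n" "h < n"
    have "?w k h \<le> ?w (Suc k) h"
      using f \<pi> n h(1) by (intro vord_orbit_diff_mono) (auto intro: dvd_pos_nat)
    also have "\<dots> \<le> divisor_max (?w (Suc k)) n" using divisor_max_ge[of h n "?w (Suc k)"] h by simp
    finally show "?w k h \<le> divisor_max (?w (Suc k)) n" .
  qed
  moreover have "vord \<pi> (dynatomic_iterate f (Suc k) n)
      = vord \<pi> (gen_dynatomic f (Suc k) n) + vord \<pi> (dynatomic_iterate f k n)"
    unfolding gen_dynatomic_Suc_mult[OF f n, symmetric]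
    by (rule vord_mult[OF \<pi> gen_dynatomic_nonzero[OF f n] dynatomic_iterate_nonzero[OF f n]])
  ultimately show ?thesis
    using vord_dynatomic_iterate[OF f n \<pi>, of k] vord_dynatomic_iterate[OF f n \<pi>, of "Suc k"]
    by linarith
qed

lemma orbit_diff_cong_dvd:
  assumes "j mod n = j' mod n" "s \<le> i + j" "s \<le> i + j'"
  shows "orbit_diff f s n dvd orbit_diff f i j - orbit_diff f i j'"
proof -
  have "orbit_diff f s n dvd poly_iterate f (i + j) - poly_iterate f (i + j')"
    using assms by (intro dvd_iterate_diff_if_cong[OF dvd_refl]) (auto intro: mod_add_cong)
  then show ?thesis by (simp add: orbit_diff_def)
qed

text \<open>The heart of the matter: locally at \<open>\<pi>\<close>, the quotient of two orbit differences whose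
  periods agree modulo \<open>n\<close> is \<open>1\<close> modulo the generalized dynatomic polynomial, even where the
  orbit differences are not units. If \<open>n\<close> does not divide \<open>j\<close>, then \<open>gcd j n\<close> is a proper
  divisor of \<open>n\<close>, and the valuation of the dynatomic polynomial is by construction at most the
  amount by which the valuation at \<open>n\<close> exceeds that at this divisor. If \<open>n\<close> divides \<open>j\<close> and
  \<open>i < m\<close>, then either the orbit difference is a unit, or \<open>f\<^sup>i(x)\<close> is periodic modulo \<open>\<pi>\<close>. In
  the latter case \<open>\<pi>\<close> divides the generalized dynatomic polynomial only because the cycle is
  superattracting, and on such a cycle all orbit differences of periods divisible by \<open>n\<close> have
  the same valuation.\<close>
lemma orbit_diff_cong_mod_gen_dynatomic:
  assumes f: "degree f \<ge> 2" and n: "n > 0" and \<pi>: "prime_elem \<pi>" "\<pi> dvd gen_dynatomic f m n"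
    and j: "j > 0" "j mod n = j' mod n" "m \<le> i + j" "m \<le> i + j'"
    and side: "\<not> n dvd j \<or> i < m"
  shows "\<pi> ^ (vord \<pi> (gen_dynatomic f m n) + vord \<pi> (orbit_diff f i j))
           dvd orbit_diff f i j - orbit_diff f i j'"
proof -
  define s where "s = min (i + j) (i + j')"
  define A where "A = vord \<pi> (gen_dynatomic f m n)"
  define w where "w i j = vord \<pi> (orbit_diff f i j)" for i j
  have s: "m \<le> s" "i \<le> s" using j by (auto simp: s_def)
  have A: "A > 0" unfolding A_def using \<pi> vord_pos_iff gen_dynatomic_nonzero[OF f n] by blast
  note mono = vord_orbit_diff_mono[OF f \<pi>(1), folded w_def]
  have dvd_iff: "\<pi> dvd orbit_diff f a b \<longleftrightarrow> w a b > 0" if "b > 0" for a b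
    using vord_pos_iff[OF \<pi>(1) orbit_diff_nonzero[OF f that]] by (simp add: w_def)
  \<comment> \<open>The difference of the two orbit differences is a multiple of \<open>orbit_diff f s n\<close>, as both
    orbits have reached index \<open>s\<close>.\<close>
  have "A + w i j \<le> w s n"
  proof (cases "n dvd j")
    case False
    define g where "g = gcd j n"
    have g: "g dvd n" "g dvd j" "g > 0" using j(1) by (auto simp: g_def)
    have "g \<noteq> n" using False g(2) by auto
    then have "g < n" using g(1) n by (simp add: dvd_imp_le le_neq_implies_less)
    then have "w s g \<le> divisor_max (w s) n" using g(1) by (intro divisor_max_ge)
    moreover have "A \<le> vord \<pi> (dynatomic_iterate f s n)"
      unfolding A_def using gen_dynatomic_dvd_dynatomic_iterate[OF f n] dynatomic_iterate_dvd_mono[OF f n s(1)]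
      by (intro vord_mono[OF \<pi>(1)] dynatomic_iterate_nonzero[OF f n]) (rule dvd_trans)
    ultimately have *: "A + w s g \<le> w s n"
      using vord_dynatomic_iterate[OF f n \<pi>(1), of s] by (simp add: w_def[abs_def])
    moreover have "w s g = min (w s j) (w s n)"
      unfolding w_def g_def by (rule vord_orbit_diff_gcd[OF f \<pi>(1) j(1) n])
    ultimately have "w s j = w s g" using A by linarith
    moreover have "w i j \<le> w s j" using s(2) j(1) by (intro mono) auto
    ultimately show ?thesis using * by linarith
  next
    case True
    with side obtain k where k: "m = Suc k" "i \<le> k" by (cases m) auto
    have bound: "A + w k n \<le> w (Suc k) n"
      using vord_gen_dynatomic_Suc[OF f n \<pi>(1), of k] by (simp add: A_def w_def k)
    have "w (Suc k) n \<le> w s n" using s(1) k n by (intro mono) auto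
    moreover have "w i j \<le> w k n"
    proof (cases "w i j = 0")
      case False
      have "\<pi> dvd orbit_diff f i j" using False j(1) by (simp add: dvd_iff)
      moreover have "\<pi> dvd orbit_diff f (Suc k) n" using bound A n by (simp add: dvd_iff)
      ultimately have per: "\<pi> dvd orbit_diff f i n"
        using dvd_orbit_diff_periodic[of \<pi> f i j "Suc k" n] j(1) k(2) by simp
      have "\<pi> dvd orbit_diff f k n"
        using per orbit_diff_dvd_orbit_diff[OF k(2) dvd_refl] by (rule dvd_trans)
      \<comment> \<open>The valuation jumps from \<open>k\<close> to \<open>Suc k\<close>, which only a vanishing derivative can cause.\<close>
      then have crit: "\<pi> dvd pcompose (pderiv f) (poly_iterate f k)"
        using vord_orbit_diff_Suc_eq_iff[OF f \<pi>(1) n, of k] bound A by (auto simp: w_def)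
      \<comment> \<open>The orbit is periodic modulo \<open>\<pi>\<close> from index \<open>i\<close> on, so it meets the critical residue of
        index \<open>k\<close> already within the first period.\<close>
      define t where "t = i + (k - i) mod n"
      have t: "i \<le> t" "t < i + n" "t mod n = k mod n"
        using n k(2) by (auto simp: t_def mod_add_right_eq)
      have "\<pi> dvd poly_iterate f t - poly_iterate f k"
        using per t k(2) by (intro dvd_iterate_diff_if_cong)
      then have "\<pi> dvd pcompose (pderiv f) (poly_iterate f t) - pcompose (pderiv f) (poly_iterate f k)"
        by (rule dvd_pcompose_diff)
      from dvd_add[OF this crit] have "\<pi> dvd pcompose (pderiv f) (poly_iterate f t)" by simp
      moreover have "\<pi> dvd orbit_diff f t n"
        using per orbit_diff_dvd_orbit_diff[OF t(1) dvd_refl] by (rule dvd_trans)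
      ultimately have "w (Suc t) n \<noteq> w t n"
        using vord_orbit_diff_Suc_eq_iff[OF f \<pi>(1) n, of t] by (auto simp: w_def)
      \<comment> \<open>The jump at \<open>t\<close> lies in the window from \<open>i\<close> to \<open>i + n\<close>.\<close>
      moreover have "w t n \<le> w (Suc t) n" "w i n \<le> w t n" "w (Suc t) n \<le> w (i + n) n"
        using t n by (auto intro!: mono)
      ultimately have "Suc (w i n) \<le> w (i + n) n" by linarith
      then have "\<pi> ^ Suc (w i n) dvd orbit_diff f (i + n) n"
        using power_dvd_iff_vord[OF \<pi>(1) orbit_diff_nonzero[OF f n]] by (simp add: w_def del: power_Suc)
      also have "orbit_diff f (i + n) n dvd orbit_diff f i j - orbit_diff f i n"
        using True j(1) by (intro orbit_diff_cong_dvd) (auto dest: dvd_imp_le)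
      finally have "w i j = w i n"
        unfolding w_def by (intro vord_eq_if_diff[OF \<pi>(1)] orbit_diff_nonzero[OF f]) (use j n in auto)
      also have "\<dots> \<le> w k n" using k(2) n by (intro mono) auto
      finally show ?thesis .
    qed simp
    ultimately show ?thesis using bound by linarith
  qed
  then have "\<pi> ^ (A + w i j) dvd orbit_diff f s n"
    using power_dvd_iff_vord[OF \<pi>(1) orbit_diff_nonzero[OF f n]] by (simp add: w_def)
  also have "\<dots> dvd orbit_diff f i j - orbit_diff f i j'"
    using j by (intro orbit_diff_cong_dvd) (auto simp: s_def)
  finally show ?thesis by (simp add: A_def w_def)
qed

section \<open>Principal units and balanced products\<close>

text \<open>The \<open>\<pi>\<close>-local units congruent to \<open>1\<close> modulo \<open>\<pi> ^ A\<close>, that is, the \<open>A\<close>th higher unit group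
  inside the fraction field.\<close>
definition principal_units :: "'a::field poly \<Rightarrow> nat \<Rightarrow> 'a poly fract set" where
  "principal_units \<pi> A =
     {to_fract a / to_fract b | a b. \<not> \<pi> dvd a \<and> \<not> \<pi> dvd b \<and> \<pi> ^ A dvd a - b}"

lemma principal_unitsI:
  "\<not> \<pi> dvd a \<Longrightarrow> \<not> \<pi> dvd b \<Longrightarrow> \<pi> ^ A dvd a - b \<Longrightarrow> to_fract a / to_fract b \<in> principal_units \<pi> A"
  by (auto simp: principal_units_def)

lemma principal_units_one: "prime_elem \<pi> \<Longrightarrow> 1 \<in> principal_units \<pi> A"
  using principal_unitsI[of \<pi> 1 1 A] by (simp add: prime_elem_def)

lemma principal_units_mult:
  assumes "prime_elem \<pi>" "x \<in> principal_units \<pi> A" "y \<in> principal_units \<pi> A"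
  shows "x * y \<in> principal_units \<pi> A"
proof -
  obtain a b where x: "x = to_fract a / to_fract b" "\<not> \<pi> dvd a" "\<not> \<pi> dvd b" "\<pi> ^ A dvd a - b"
    using assms(2) by (auto simp: principal_units_def)
  obtain c d where y: "y = to_fract c / to_fract d" "\<not> \<pi> dvd c" "\<not> \<pi> dvd d" "\<pi> ^ A dvd c - d"
    using assms(3) by (auto simp: principal_units_def)
  have "\<pi> ^ A dvd (a - b) * c + b * (c - d)" using x(4) y(4) by simp
  then have "\<pi> ^ A dvd a * c - b * d" by (simp add: algebra_simps)
  then show ?thesis
    using principal_unitsI[of \<pi> "a * c" "b * d" A] assms(1) x y
    by (simp add: prime_elem_dvd_mult_iff)
qed

lemma principal_units_inverse:
  assumes "x \<in> principal_units \<pi> A"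
  shows "inverse x \<in> principal_units \<pi> A"
proof -
  obtain a b where x: "x = to_fract a / to_fract b" "\<not> \<pi> dvd a" "\<not> \<pi> dvd b" "\<pi> ^ A dvd a - b"
    using assms by (auto simp: principal_units_def)
  then show ?thesis using principal_unitsI[of \<pi> b a A] by (simp add: dvd_diff_commute)
qed

lemma principal_units_divide:
  assumes "prime_elem \<pi>" "x \<in> principal_units \<pi> A" "y \<in> principal_units \<pi> A"
  shows "x / y \<in> principal_units \<pi> A"
  using assms by (simp add: divide_inverse principal_units_mult principal_units_inverse)

lemma principal_units_power_int:
  assumes "prime_elem \<pi>" "x \<in> principal_units \<pi> A"
  shows "x powi k \<in> principal_units \<pi> A"
proof -
  have "x ^ t \<in> principal_units \<pi> A" for t
    by (induction t) (auto intro: principal_units_one principal_units_mult assms)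
  then show ?thesis
    by (auto simp: power_int_def power_inverse intro: principal_units_inverse)
qed

lemma principal_units_prod:
  assumes "prime_elem \<pi>" "\<And>e. e \<in> D \<Longrightarrow> g e \<in> principal_units \<pi> A"
  shows "prod g D \<in> principal_units \<pi> A"
  using assms(2) by (induction D rule: infinite_finite_induct)
    (auto intro: principal_units_one principal_units_mult assms(1))

lemma principal_units_ratioI:
  assumes "prime_elem \<pi>" "x \<noteq> 0" "A > 0" "\<pi> ^ (A + vord \<pi> x) dvd x - y"
  shows "to_fract x / to_fract y \<in> principal_units \<pi> A"
proof -
  obtain a where a: "x = \<pi> ^ vord \<pi> x * a" "\<not> \<pi> dvd a" using vord_decompose[OF assms(1,2)] .
  obtain u where u: "x - y = \<pi> ^ (A + vord \<pi> x) * u" using assms(4) by (rule dvdE)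
  \<comment> \<open>Cancelling \<open>\<pi> ^ vord \<pi> x\<close> from \<open>x\<close> and \<open>y\<close> leaves \<open>a\<close> and \<open>b\<close>.\<close>
  define b where "b = a - \<pi> ^ A * u"
  have y: "y = \<pi> ^ vord \<pi> x * b"
  proof -
    have "y = x - (x - y)" by simp
    also have "\<dots> = \<pi> ^ vord \<pi> x * a - \<pi> ^ (A + vord \<pi> x) * u" using u a(1) by simp
    also have "\<dots> = \<pi> ^ vord \<pi> x * b" by (simp add: b_def power_add algebra_simps)
    finally show ?thesis .
  qed
  have "\<pi> dvd \<pi> ^ A * u" using assms(3) by (simp add: dvd_mult2 dvd_power)
  then have "\<not> \<pi> dvd b" using a(2) by (metis b_def diff_add_cancel dvd_add)
  then have "to_fract a / to_fract b \<in> principal_units \<pi> A"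
    using a(2) by (intro principal_unitsI) (simp_all add: b_def)
  moreover have "\<pi> \<noteq> 0" using assms(1) by auto
  then have "to_fract x / to_fract y = to_fract a / to_fract b"
    by (subst a(1), subst y) simp
  ultimately show ?thesis by simp
qed

lemma dvd_minus_1_if_principal_unit:
  assumes "prime_elem \<pi>" "to_fract p \<in> principal_units \<pi> A"
  shows "\<pi> ^ A dvd p - 1"
proof (cases "p - 1 = 0")
  case False
  obtain a b where ab: "to_fract p = to_fract a / to_fract b" "\<not> \<pi> dvd a" "\<not> \<pi> dvd b" "\<pi> ^ A dvd a - b"
    using assms(2) by (auto simp: principal_units_def)
  have nz: "b \<noteq> 0" using ab(3) by auto
  then have "to_fract (p * b) = to_fract a" using ab(1) by simp
  then have "a - b = b * (p - 1)" by (simp only: to_fract_eq_iff) (simp add: algebra_simps)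
  then have "A \<le> vord \<pi> (b * (p - 1))"
    using ab(4) power_dvd_iff_vord[OF assms(1), of "b * (p - 1)" A] nz False by simp
  also have "\<dots> = vord \<pi> (p - 1)"
    using vord_mult[OF assms(1) nz False] vord_pos_iff[OF assms(1) nz] ab(3) by simp
  finally show ?thesis using power_dvd_iff_vord[OF assms(1) False] by simp
qed simp

lemma prod_power_int_const:
  fixes x :: "'b::field"
  assumes "x \<noteq> 0"
  shows "(\<Prod>e\<in>D. x powi c e) = x powi (\<Sum>e\<in>D. c e)"
  by (induction D rule: infinite_finite_induct) (auto simp: power_int_add assms)

text \<open>Within a class all factors agree up to principal units, and the exponents add up to zero,
  so that the common factor drops out. The factors themselves may have a zero or a pole at \<open>\<pi>\<close>.\<close>
lemma principal_units_balanced_prod: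
  assumes \<pi>: "prime_elem \<pi>" and D: "finite D"
    and nz: "\<And>e. e \<in> D \<Longrightarrow> H e \<noteq> 0"
    and bal: "\<And>r. (\<Sum>e | e \<in> D \<and> cls e = r. c e) = (0::int)"
    and ratio: "\<And>e e'. e \<in> D \<Longrightarrow> e' \<in> D \<Longrightarrow> c e \<noteq> 0 \<Longrightarrow> c e' \<noteq> 0 \<Longrightarrow> cls e = cls e'
                 \<Longrightarrow> H e / H e' \<in> principal_units \<pi> A"
  shows "(\<Prod>e\<in>D. H e powi c e) \<in> principal_units \<pi> A"
proof -
  have "(\<Prod>e | e \<in> D \<and> cls e = r. H e powi c e) \<in> principal_units \<pi> A" for r
  proof (cases "\<exists>e0\<in>D. cls e0 = r \<and> c e0 \<noteq> 0")
    case False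
    then have "(\<Prod>e | e \<in> D \<and> cls e = r. H e powi c e) = 1" by (intro prod.neutral) auto
    then show ?thesis using principal_units_one[OF \<pi>] by simp
  next
    case True
    then obtain e0 where e0: "e0 \<in> D" "cls e0 = r" "c e0 \<noteq> 0" by blast
    have "(\<Prod>e | e \<in> D \<and> cls e = r. H e powi c e)
        = (\<Prod>e | e \<in> D \<and> cls e = r. H e0 powi c e * (H e / H e0) powi c e)"
      using nz[OF e0(1)] by (intro prod.cong refl) (simp flip: power_int_mult_distrib)
    also have "\<dots> = (\<Prod>e | e \<in> D \<and> cls e = r. (H e / H e0) powi c e)"
      using nz[OF e0(1)] by (simp add: prod.distrib prod_power_int_const bal)
    also have "\<dots> \<in> principal_units \<pi> A"
    proof (rule principal_units_prod[OF \<pi>])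
      fix e assume e: "e \<in> {e \<in> D. cls e = r}"
      show "(H e / H e0) powi c e \<in> principal_units \<pi> A"
        using e e0 ratio[of e e0] by (cases "c e = 0")
          (auto intro: principal_units_one[OF \<pi>] principal_units_power_int[OF \<pi>])
    qed
    finally show ?thesis .
  qed
  moreover have "(\<Prod>e\<in>D. H e powi c e)
      = (\<Prod>r\<in>cls ` D. \<Prod>e | e \<in> D \<and> cls e = r. H e powi c e)"
    by (rule prod.image_gen[OF D])
  ultimately show ?thesis by (auto intro: principal_units_prod[OF \<pi>])
qed

section \<open>Divisibility of generalized dynatomic polynomials\<close>

text \<open>The factors of the product over divisors that gives the generalized dynatomic polynomial
  with preperiod \<open>c\<close>.\<close>
definition orbit_ratio :: "'a::field poly \<Rightarrow> nat \<Rightarrow> nat \<Rightarrow> 'a poly fract" where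
  "orbit_ratio f c j = (case c of 0 \<Rightarrow> to_fract (orbit_diff f 0 j)
     | Suc k \<Rightarrow> to_fract (orbit_diff f (Suc k) j) / to_fract (orbit_diff f k j))"

lemma to_fract_gen_dynatomic:
  assumes "degree f \<ge> 2" "d > 0"
  shows "to_fract (gen_dynatomic f c d) = (\<Prod>e | e dvd d. orbit_ratio f c (d div e) powi moebius_mu e)"
proof (cases c)
  case 0
  then show ?thesis using to_fract_dynatomic_iterate[OF assms, of 0] by (simp add: orbit_ratio_def)
next
  case (Suc k)
  have "to_fract (gen_dynatomic f (Suc k) d)
      = to_fract (dynatomic_iterate f (Suc k) d) / to_fract (dynatomic_iterate f k d)"
    unfolding gen_dynatomic_Suc_mult[OF assms, symmetric] to_fract_mult
    using dynatomic_iterate_nonzero[OF assms, of k] by simp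
  then show ?thesis
    unfolding Suc to_fract_dynatomic_iterate[OF assms]
    by (simp add: orbit_ratio_def power_int_divide_distrib prod_dividef)
qed

text \<open>Reduces the divisibility to a comparison of factors at one prime at a time. Only
  squarefree \<open>e\<close> occur, as the Moebius function vanishes elsewhere.\<close>
lemma gen_dynatomic_dvd_minus_1I:
  assumes f: "degree f \<ge> 2" and d: "d > 0" and n: "n > 0"
    and bal: "\<And>r. (\<Sum>e | e dvd d \<and> d div e mod n = r. moebius_mu e) = 0"
    and ratio: "\<And>\<pi> e e'. prime_elem \<pi> \<Longrightarrow> \<pi> dvd gen_dynatomic f m n \<Longrightarrow>
        e dvd d \<Longrightarrow> e' dvd d \<Longrightarrow> squarefree e \<Longrightarrow> squarefree e' \<Longrightarrow> d div e mod n = d div e' mod n \<Longrightarrow>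
        orbit_ratio f c (d div e) / orbit_ratio f c (d div e')
          \<in> principal_units \<pi> (vord \<pi> (gen_dynatomic f m n))"
  shows "gen_dynatomic f m n dvd gen_dynatomic f c d - 1"
proof (rule dvdI_vord[OF gen_dynatomic_nonzero[OF f n]])
  fix \<pi> :: "'a poly" assume \<pi>: "prime_elem \<pi>"
  show "\<pi> ^ vord \<pi> (gen_dynatomic f m n) dvd gen_dynatomic f c d - 1"
  proof (cases "\<pi> dvd gen_dynatomic f m n")
    case False
    then have "vord \<pi> (gen_dynatomic f m n) = 0"
      using vord_pos_iff[OF \<pi> gen_dynatomic_nonzero[OF f n]] by blast
    then show ?thesis by simp
  next
    case True
    show ?thesis
    proof (rule dvd_minus_1_if_principal_unit[OF \<pi>], unfold to_fract_gen_dynatomic[OF f d],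
           rule principal_units_balanced_prod[OF \<pi>, where cls = "\<lambda>e. d div e mod n"])
      fix e assume "e \<in> {e. e dvd d}"
      then have "d div e > 0" using d by (simp add: div_pos_if_dvd)
      then show "orbit_ratio f c (d div e) \<noteq> 0"
        by (simp add: orbit_ratio_def orbit_diff_nonzero[OF f] split: nat.split)
    next
      fix e e'
      assume "e \<in> {e. e dvd d}" "e' \<in> {e. e dvd d}" "moebius_mu e \<noteq> 0" "moebius_mu e' \<noteq> 0"
        and "d div e mod n = d div e' mod n"
      then show "orbit_ratio f c (d div e) / orbit_ratio f c (d div e')
          \<in> principal_units \<pi> (vord \<pi> (gen_dynatomic f m n))"
        by (intro ratio[OF \<pi> True]) (auto simp: moebius_mu_def split: if_splits)
    qed (use d bal in auto)
  qed
qed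

lemma cocore_le:
  assumes "d > 0" "e dvd d" "squarefree e"
  shows "cocore d \<le> d div e"
proof -
  have "e \<le> Max {e. e dvd d \<and> squarefree e}" using assms by (intro Max_ge) auto
  moreover have "e > 0" using assms by (auto intro: dvd_pos_nat)
  ultimately show ?thesis unfolding cocore_def by (rule div_le_mono2[rotated])
qed

text \<open>Modulo \<open>x\<^sup>n - 1\<close> a power of \<open>x\<close> depends only on its exponent modulo \<open>n\<close>, so the hypothesis
  says that the Moebius function sums to zero over each class of codivisors.\<close>
lemma necklace_poly_balanced:
  assumes n: "n > 0" and d: "d > 0" and dvd: "(monom 1 n - 1) dvd necklace_poly d"
  shows "(\<Sum>e | e dvd d \<and> d div e mod n = r. moebius_mu e) = 0"
proof -
  let ?X = "monom 1 n - 1 :: rat poly"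
  let ?D = "{e. e dvd d}"
  define c :: "nat \<Rightarrow> rat" where "c e = of_int (moebius_mu e)" for e
  define S where "S = (\<Sum>e\<in>?D. monom (c e) (d div e))"
  define T where "T = (\<Sum>e\<in>?D. monom (c e) (d div e mod n))"
  have fin: "finite ?D" using d by simp
  have "S = smult (of_nat d) (necklace_poly d)" using d by (simp add: S_def c_def necklace_poly_def)
  then have "?X dvd S" using dvd by (simp add: dvd_smult)
  \<comment> \<open>Reducing exponents modulo \<open>n\<close> replaces the necklace sum by a polynomial of degree below
    \<open>n\<close>.\<close>
  have red: "?X dvd monom a k - monom a (k mod n)" for a k
  proof -
    have "monom a k - monom a (k mod n) = monom a (k mod n) * (monom 1 n ^ (k div n) - 1)"
      by (simp add: monom_power mult_monom right_diff_distrib)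
    moreover have "?X dvd monom 1 n ^ (k div n) - 1"
      by (simp add: power_diff_1_eq)
    ultimately show ?thesis by simp
  qed
  have "?X dvd S - T" unfolding S_def T_def sum_subtractf[symmetric] by (intro dvd_sum red)
  with \<open>?X dvd S\<close> have "?X dvd T" by (metis dvd_diff_commute dvd_add diff_add_cancel)
  have degX: "degree ?X = n" 
    using n degree_add_eq_left[of "-1" "monom 1 n :: rat poly"] by (simp add: degree_monom_eq)
  have "degree T \<le> n - 1"
    unfolding T_def
  proof (rule degree_sum_le[OF fin])
    show "degree (monom (c e) (d div e mod n)) \<le> n - 1" for e
      using degree_monom_le[of "c e" "d div e mod n"] mod_less_divisor[OF n, of "d div e"] by linarith
  qed
  then have "T = 0"
    using dvd_imp_degree_le[OF \<open>?X dvd T\<close>] degX n by (cases "T = 0") auto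
  then have "0 = coeff T r" by simp
  also have "\<dots> = (\<Sum>e\<in>?D. if d div e mod n = r then c e else 0)"
    by (simp add: T_def coeff_sum eq_commute)
  also have "\<dots> = of_int (\<Sum>e | e dvd d \<and> d div e mod n = r. moebius_mu e)"
    using fin by (simp add: sum.inter_filter[symmetric] c_def)
  finally show ?thesis by (metis of_int_eq_0_iff)
qed

text \<open>For \<open>c > 0\<close> each factor is a quotient of orbit differences at indices \<open>c\<close> and \<open>c - 1\<close>. The
  bound on the cocore ensures that from either index every relevant codivisor \<open>d div e\<close> leads to
  an index of at least \<open>m\<close>, where the orbit has become periodic.\<close>
lemma gen_dynatomic_dvd_if_necklace:
  assumes f: "degree f \<ge> 2" and d: "d > 0" and n: "n > 0"
    and side: "c < m \<or> \<not> n dvd d"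
    and cocore: "int m - max (int c - 1) 0 \<le> int (cocore d)"
    and neck: "(monom 1 n - 1) dvd necklace_poly d"
  shows "gen_dynatomic f m n dvd gen_dynatomic f c d - 1"
proof (rule gen_dynatomic_dvd_minus_1I[OF f d n necklace_poly_balanced[OF n d neck]])
  fix \<pi> :: "'a poly" and e e'
  assume \<pi>: "prime_elem \<pi>" "\<pi> dvd gen_dynatomic f m n"
    and e: "e dvd d" "e' dvd d" "squarefree e" "squarefree e'" "d div e mod n = d div e' mod n"
  define A where "A = vord \<pi> (gen_dynatomic f m n)"
  have A: "A > 0" unfolding A_def using \<pi> vord_pos_iff gen_dynatomic_nonzero[OF f n] by blast
  have pos: "d div e > 0" using e d by (simp add: div_pos_if_dvd)
  have "cocore d \<le> d div e" "cocore d \<le> d div e'" using cocore_le[OF d] e by auto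
  have indiv: "\<not> n dvd d div e \<or> c < m"
    using side e(1) by (metis dvd_div_mult_self dvd_mult2)
  have unit: "to_fract (orbit_diff f i (d div e)) / to_fract (orbit_diff f i (d div e'))
      \<in> principal_units \<pi> A" if i: "i \<le> c" "c \<le> Suc i" for i
  proof (rule principal_units_ratioI[OF \<pi>(1) orbit_diff_nonzero[OF f pos] A], unfold A_def,
         rule orbit_diff_cong_mod_gen_dynatomic[OF f n \<pi> pos e(5)])
    have "max (int c - 1) 0 \<le> int i" using i(2) by simp
    with cocore have "m \<le> i + cocore d" by linarith
    then show "m \<le> i + d div e" "m \<le> i + d div e'"
      using \<open>cocore d \<le> d div e\<close> \<open>cocore d \<le> d div e'\<close> by linarith+
    show "\<not> n dvd d div e \<or> i < m" using indiv i(1) by auto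
  qed
  show "orbit_ratio f c (d div e) / orbit_ratio f c (d div e')
      \<in> principal_units \<pi> (vord \<pi> (gen_dynatomic f m n))"
  proof (cases c)
    case 0
    then show ?thesis using unit[of 0] by (simp add: orbit_ratio_def A_def)
  next
    case (Suc k)
    then show ?thesis
      using principal_units_divide[OF \<pi>(1) unit[of "Suc k"] unit[of k]]
      by (simp add: orbit_ratio_def A_def field_simps)
  qed
qed

text \<open>Let \<open>g\<close> be a greatest common divisor of \<open>f(x) - x\<close> and the derivative \<open>f'(x)\<close>. As the
  derivative of \<open>f(x) - x\<close> is \<open>-1\<close> modulo \<open>g\<close>, the cofactor of \<open>g\<close> in \<open>f(x) - x\<close> is prime to
  \<open>g\<close>. At a superattracting fixed point the valuation of \<open>f(x) - x\<close> is therefore that of \<open>g\<close>,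
  which divides \<open>f'(x)\<close>. Evaluating the identity at \<open>f\<^sup>i(x)\<close> gives the claim, also when the
  residue field is inseparable over \<open>K\<close>.\<close>
lemma vord_multiplier_ge:
  assumes f: "degree f \<ge> 2" and \<pi>: "prime_elem \<pi>"
    and fix_pt: "\<pi> dvd orbit_diff f i 1" and crit: "\<pi> dvd pcompose (pderiv f) (poly_iterate f i)"
  shows "\<pi> ^ vord \<pi> (orbit_diff f i 1) dvd pcompose (pderiv f) (poly_iterate f i)"
proof -
  let ?z = "poly_iterate f i"
  obtain g u v where g: "g dvd orbit_diff f 0 1" "g dvd pderiv f" "g = u * orbit_diff f 0 1 + v * pderiv f"
    using poly_bezout by blast
  obtain h where h: "orbit_diff f 0 1 = g * h" using g(1) by (rule dvdE)
  obtain k where k: "pderiv f = g * k" using g(2) by (rule dvdE)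
  \<comment> \<open>Here \<open>f - x = g * h\<close> and \<open>f' = g * k\<close>; differentiating \<open>f - x\<close> makes \<open>h\<close> invertible modulo
    \<open>g\<close>.\<close>
  have "pderiv (orbit_diff f 0 1) = pderiv f - 1"
    by (simp add: orbit_diff_def poly_iterate_Suc pderiv_diff pderiv_pCons one_pCons)
  then have "1 = g * k - (g * pderiv h + h * pderiv g)"
    using h k by (simp add: pderiv_mult algebra_simps)
  then have one: "1 = g * (k - pderiv h) + h * (- pderiv g)" by (simp add: algebra_simps)
  have od: "orbit_diff f i 1 = pcompose g ?z * pcompose h ?z"
    using pcompose_orbit_diff[of f 0 1 i] h by (simp add: pcompose_mult)
  have "pcompose g ?z = pcompose u ?z * orbit_diff f i 1 + pcompose v ?z * pcompose (pderiv f) ?z"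
    by (subst g(3)) (use pcompose_orbit_diff[of f 0 1 i] in \<open>simp add: pcompose_add pcompose_mult\<close>)
  then have pg: "\<pi> dvd pcompose g ?z" using fix_pt crit by simp
  have ph: "\<not> \<pi> dvd pcompose h ?z"
  proof
    assume ph: "\<pi> dvd pcompose h ?z"
    have "(1::'a poly) = pcompose g ?z * pcompose (k - pderiv h) ?z + pcompose h ?z * pcompose (- pderiv g) ?z"
      using arg_cong[OF one, of "\<lambda>p. pcompose p ?z"]
      by (simp only: pcompose_1 pcompose_add pcompose_mult)
    then have "\<pi> dvd 1" using pg ph by (metis dvd_add dvd_mult2)
    then show False using \<pi> by (simp add: prime_elem_def)
  qed
  have nz: "pcompose g ?z \<noteq> 0" "pcompose h ?z \<noteq> 0"
    using od orbit_diff_nonzero[OF f, of 1 i] by auto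
  have "vord \<pi> (orbit_diff f i 1) = vord \<pi> (pcompose g ?z)"
    using vord_mult[OF \<pi> nz] vord_pos_iff[OF \<pi> nz(2)] ph od by simp
  then have "\<pi> ^ vord \<pi> (orbit_diff f i 1) dvd pcompose g ?z"
    using power_dvd_iff_vord[OF \<pi> nz(1)] by simp
  also have "pcompose g ?z dvd pcompose (pderiv f) ?z" using g(2) by (rule pcompose_dvd_mono)
  finally show ?thesis .
qed

text \<open>Near a superattracting fixed point one application of \<open>f\<close> at least doubles the valuation
  of the distance to it, so that \<open>f\<^sup>i\<^sup>+\<^sup>j(x)\<close> for \<open>j > 0\<close> agrees with the fixed point to the
  precision that matters.\<close>
lemma orbit_diff_cong_superattracting:
  assumes f: "degree f \<ge> 2" and \<pi>: "prime_elem \<pi>" and j: "j > 0" "j' > 0"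
    and fix_pt: "\<pi> dvd orbit_diff f i 1" and crit: "\<pi> dvd pcompose (pderiv f) (poly_iterate f i)"
  shows "\<pi> ^ (vord \<pi> (orbit_diff f i 1) + vord \<pi> (orbit_diff f i j))
           dvd orbit_diff f i j - orbit_diff f i j'"
proof -
  define w where "w = vord \<pi> (orbit_diff f i 1)"
  have nz: "orbit_diff f i 1 \<noteq> 0" using orbit_diff_nonzero[OF f] by simp
  have w: "w > 0" using vord_pos_iff[OF \<pi> nz] fix_pt by (simp add: w_def)
  have pw: "\<pi> ^ w dvd orbit_diff f i 1" using power_dvd_iff_vord[OF \<pi> nz] by (simp add: w_def)
  obtain G where G: "orbit_diff f (Suc i) 1 = orbit_diff f i 1 * G"
      "orbit_diff f i 1 dvd G - pcompose (pderiv f) (poly_iterate f i)"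
    using orbit_diff_Suc by blast
  have "\<pi> ^ w dvd G - pcompose (pderiv f) (poly_iterate f i)" using pw G(2) by (rule dvd_trans)
  moreover have "\<pi> ^ w dvd pcompose (pderiv f) (poly_iterate f i)"
    unfolding w_def by (rule vord_multiplier_ge[OF f \<pi> fix_pt crit])
  ultimately have "\<pi> ^ w dvd G" by (metis diff_add_cancel dvd_add)
  then have "\<pi> ^ (w + w) dvd orbit_diff f (Suc i) 1"
    unfolding G(1) power_add using pw by (rule mult_dvd_mono[rotated])
  moreover have "orbit_diff f (Suc i) 1 dvd orbit_diff f i a - orbit_diff f i b" if "a > 0" "b > 0" for a b
    using that by (intro orbit_diff_cong_dvd) auto
  ultimately have ww: "\<pi> ^ (w + w) dvd orbit_diff f i a - orbit_diff f i b" if "a > 0" "b > 0" for a b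
    using that by (metis dvd_trans)
  have *: "\<pi> ^ Suc w dvd \<pi> ^ (w + w)" using w by (intro le_imp_power_dvd) simp
  then have "vord \<pi> (orbit_diff f i j) = w"
    unfolding w_def
    by (intro vord_eq_if_diff[OF \<pi> nz] orbit_diff_nonzero[OF f j(1)])
       (use dvd_trans[OF * ww[of j 1]] j(1) in \<open>simp add: w_def del: power_Suc\<close>)
  then show ?thesis using ww[OF j] by (simp add: w_def)
qed

text \<open>With \<open>n = 1\<close> all codivisors are congruent and the exponents balance since \<open>d > 1\<close>. As
  \<open>c > m\<close>, the orbit differences at the indices \<open>c - 1\<close> and \<open>c\<close> vanish modulo \<open>\<pi>\<close>. If the
  multiplier of the fixed point is a unit, the ratios of orbit differences at these two indices
  are all congruent to it. If not, superattraction allows the orbit differences at each index to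
  be compared separately.\<close>
lemma gen_dynatomic_1_dvd:
  assumes f: "degree f \<ge> 2" and d: "d > 1" and c: "m < c"
  shows "gen_dynatomic f m 1 dvd gen_dynatomic f c d - 1"
proof (rule gen_dynatomic_dvd_minus_1I[OF f])
  show "(\<Sum>e | e dvd d \<and> d div e mod 1 = r. moebius_mu e) = 0" for r
    using moebius_sum_eq_0[OF d] by (cases "r = 0") auto
next
  fix \<pi> :: "'a poly" and e e'
  assume \<pi>: "prime_elem \<pi>" "\<pi> dvd gen_dynatomic f m 1"
    and e: "e dvd d" "e' dvd d" "squarefree e" "squarefree e'" "d div e mod 1 = d div e' mod 1"
  define A where "A = vord \<pi> (gen_dynatomic f m 1)"
  obtain k where k: "c = Suc k" "m \<le> k" using c by (cases c) auto
  have gnz: "gen_dynatomic f m 1 \<noteq> 0" using gen_dynatomic_nonzero[OF f] by simp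
  have A: "A > 0" unfolding A_def using \<pi> vord_pos_iff gnz by blast
  define j j' where "j = d div e" and "j' = d div e'"
  have j: "j > 0" "j' > 0" using e d by (auto simp: j_def j'_def div_pos_if_dvd)
  have nz: "orbit_diff f i a \<noteq> 0" if "a > 0" for i a using orbit_diff_nonzero[OF f that] .
  have "\<pi> ^ A dvd gen_dynatomic f m 1" using power_dvd_iff_vord[OF \<pi>(1) gnz] by (simp add: A_def)
  also have "\<dots> dvd dynatomic_iterate f m 1" by (rule gen_dynatomic_dvd_dynatomic_iterate[OF f]) simp
  also have "\<dots> dvd orbit_diff f m 1" by (rule dynatomic_iterate_dvd_orbit_diff[OF f]) simp
  finally have Am: "\<pi> ^ A dvd orbit_diff f m 1" .
  have Ai: "\<pi> ^ A dvd orbit_diff f i a" if "m \<le> i" for i a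
    by (rule dvd_trans[OF Am orbit_diff_dvd_orbit_diff[OF that]]) simp
  have pA: "\<pi> dvd \<pi> ^ A" using A by (simp add: dvd_power)
  have pi: "\<pi> dvd orbit_diff f i a" if "m \<le> i" for i a using pA Ai[OF that] by (rule dvd_trans)
  let ?D = "\<lambda>i. pcompose (pderiv f) (poly_iterate f i)"
  have "orbit_ratio f c j / orbit_ratio f c j' \<in> principal_units \<pi> A"
  proof (cases "\<pi> dvd ?D k")
    case False
    have "\<exists>G. orbit_ratio f c a = to_fract G \<and> \<pi> ^ A dvd G - ?D k" if "a > 0" for a
    proof -
      obtain G where G: "orbit_diff f (Suc k) a = orbit_diff f k a * G" "orbit_diff f k a dvd G - ?D k"
        using orbit_diff_Suc by blast
      then have "orbit_ratio f c a = to_fract G" using nz[OF that] by (simp add: orbit_ratio_def k)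
      moreover have "\<pi> ^ A dvd G - ?D k" using Ai[OF k(2)] G(2) by (rule dvd_trans)
      ultimately show ?thesis by blast
    qed
    then obtain G G' where G: "orbit_ratio f c j = to_fract G" "\<pi> ^ A dvd G - ?D k"
        and G': "orbit_ratio f c j' = to_fract G'" "\<pi> ^ A dvd G' - ?D k" using j by meson
    have unit: "\<not> \<pi> dvd H" if "\<pi> ^ A dvd H - ?D k" for H
    proof
      assume "\<pi> dvd H"
      moreover have "\<pi> dvd H - ?D k" using pA that by (rule dvd_trans)
      ultimately have "\<pi> dvd H - (H - ?D k)" by (rule dvd_diff)
      then show False using False by simp
    qed
    have "\<pi> ^ A dvd G - G'" using dvd_diff[OF G(2) G'(2)] by simp
    then show ?thesis unfolding G(1) G'(1) using unit G(2) G'(2) by (intro principal_unitsI)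
  next
    case True
    have D: "\<pi> dvd ?D i" if "k \<le> i" for i
    proof -
      have "\<pi> dvd poly_iterate f i - poly_iterate f k"
        using pi[OF k(2), of "i - k"] that by (simp add: orbit_diff_def)
      then have "\<pi> dvd ?D i - ?D k" by (rule dvd_pcompose_diff)
      from dvd_add[OF this True] show ?thesis by simp
    qed
    have unit: "to_fract (orbit_diff f i j) / to_fract (orbit_diff f i j') \<in> principal_units \<pi> A"
      if "k \<le> i" for i
    proof (rule principal_units_ratioI[OF \<pi>(1) nz[OF j(1)] A])
      have "m \<le> i" using k(2) that by simp
      then have "A \<le> vord \<pi> (orbit_diff f i 1)"
        using Ai power_dvd_iff_vord[OF \<pi>(1) nz[OF zero_less_one]] by blast
      then have "\<pi> ^ (A + vord \<pi> (orbit_diff f i j))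
          dvd \<pi> ^ (vord \<pi> (orbit_diff f i 1) + vord \<pi> (orbit_diff f i j))"
        by (intro le_imp_power_dvd) simp
      also have "\<dots> dvd orbit_diff f i j - orbit_diff f i j'"
        by (rule orbit_diff_cong_superattracting[OF f \<pi>(1) j pi[OF \<open>m \<le> i\<close>] D[OF that]])
      finally show "\<pi> ^ (A + vord \<pi> (orbit_diff f i j)) dvd orbit_diff f i j - orbit_diff f i j'" .
    qed
    show ?thesis
      using principal_units_divide[OF \<pi>(1) unit[of "Suc k"] unit[of k]]
      by (simp add: orbit_ratio_def k field_simps)
  qed
  then show "orbit_ratio f c (d div e) / orbit_ratio f c (d div e')
      \<in> principal_units \<pi> (vord \<pi> (gen_dynatomic f m 1))"
    by (simp add: A_def j_def j'_def)
qed (use d in auto)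

theorem theorem1p1:
  fixes f :: "'a::field poly" and c d m n :: nat
  assumes "degree f \<ge> 2" and "d \<ge> 1" and "n \<ge> 1"
  shows "((m > c \<or> \<not> n dvd d)
           \<and> int (cocore d) \<ge> int m - max (int c - 1) 0
           \<and> (monom 1 n - 1) dvd necklace_poly d
          \<longrightarrow> gen_dynatomic f m n dvd gen_dynatomic f c d - 1)
       \<and> (d > 1 \<and> int c - 1 \<ge> int m \<and> n = 1
          \<longrightarrow> gen_dynatomic f m n dvd gen_dynatomic f c d - 1)"
  using assms gen_dynatomic_dvd_if_necklace[of f d n c m] gen_dynatomic_1_dvd[of f d m c] by auto

end
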